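(* Let $\mathcal{C}$ be a path-connected nonsymmetric topological operad with a good basepoint $\{e_k\}_{k\ge 0}$. Then $\pi_1\mathcal{C}=\{\pi_1(\mathcal{C}(k),e_k)\}_{k\ge 0}$, with the trivial homomorphisms to the symmetric groups and with the composition $$\gamma([f];[g_1],\ldots,[g_k])=[\delta]\,[\gamma(f;g_1,\ldots,g_k)]\,[\delta]^{-1},\qquad [f]\in\pi_1(\mathcal{C}(k),e_k),\ [g_i]\in\pi_1(\mathcal{C}(m_i),e_{m_i}),$$ where $m=m_1+\cdots+m_k$ and $\delta$ is the linear path from $e_m$ to $\gamma(e_k;e_{m_1},\ldots,e_{m_k})$, is a non-crossed group operad.
   Context: All spaces are compactly generated Hausdorff. A (nonsymmetric) topological operad $\mathcal{C}$ consists of spaces $\mathcal{C}(n)$, $n\ge 0$, with $\mathcal{C}(0)=*$ a point, continuous maps $\gamma:\mathcal{C}(k)\times\mathcal{C}(m_1)\times\cdots\times\mathcal{C}(m_k)\to\mathcal{C}(m_1+\cdots+m_k)$ ($k\ge1$, $m_i\ge0$) and a unit $1\in\mathcal{C}(1)$, such that $\gamma(\gamma(a;b_1,\ldots,b_k);c_1,\ldots,c_m)=\gamma(a;\gamma(b_1;c_1,\ldots,c_{m_1}),\ldots,\gamma(b_k;c_{m_1+\cdots+m_{k-1}+1},\ldots,c_m))$, $\gamma(1;a)=a$ and $\gamma(a;1,\ldots,1)=a$. It is path-connected if each $\mathcal{C}(k)$ is. A morphism of operads is a sequence of (continuous) maps preserving $\gamma$ and the unit. An operad of sets is a discrete topological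 operad. Good basepoint: $\mathcal{C}_1$ is the little intervals operad: $\mathcal{C}_1(k)$ is the space of $k$-tuples of increasing affine embeddings $[0,1]\to[0,1]$ with images having pairwise disjoint interiors, $\mathcal{C}_1(0)=*$, the unit is the identity, and $\gamma(c;d^1,\ldots,d^k)$ is the tuple of all composites $c_i\circ d^i_j$ in lexicographic order. Let $c_0=*$ and $c_k=([0,\frac1k],[\frac1k,\frac2k],\ldots,[\frac{k-1}k,1])\in\mathcal{C}_1(k)$ (an embedding is identified with its image), and let $\mathcal{C}_1(k)_0$ be the path component of $c_k$ (tuples of intervals in left-to-right order); $(\mathcal{C}_1)_0=\{\mathcal{C}_1(k)_0\}_{k\ge0}$ is a nonsymmetric suboperad. A good basepoint of $\mathcal{C}$ is $\{e_k=\eta(c_k)\}_{k\ge0}$ for a chosen morphism of nonsymmetric operads $\eta:(\mathcal{C}_1)_0\to\mathcal{C}$. For $u,v\in\mathcal{C}_1(k)_0$ the path $t\mapsto\eta((1-t)u+tv)$ is called the linear path from $\eta(u)$ to $\eta(v)$. The linear path $\delta$ from $e_m=\eta(c_m)$ to $\gamma(e_k;e_{m_1},\ldots,e_{m_k})=\eta(\gamma(c_k;c_{m_1},\ldots,c_{m_k}))$ uses $u=c_m$, $v=\gamma(c_k;c_{m_1},\ldots,c_{m_k})$. Paths are composed from left to right, and $\gamma(f;g_1,\ldots,g_k)(z)=\gamma(f(z);g_1(z),\ldots,g_k(z))$. A group operad is an operad of sets $\mathcal{G}=\{G_n\}_{n\ge0}$ with a morphism of operads $\pi:\mathcal{G}\to\mathcal{S}$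 to the symmetric groups operad $\mathcal{S}=\{S_n\}$ such that each $G_n$ is a group and $\pi:G_n\to S_n$ is a homomorphism, the identity of $G_1$ is the operad unit, and $\gamma(aa';b_1b_1',\ldots,b_kb_k')=\gamma(a;b_1,\ldots,b_k)\gamma(a';b'_{a^{-1}(1)},\ldots,b'_{a^{-1}(k)})$, where $a(i)=\pi(a)(i)$. It is non-crossed if all $\pi$ are trivial; in that case the last condition says that each $\gamma$ is a group homomorphism. *)

theory Defs
  imports "HOL-Analysis.Analysis" "HOL-Algebra.Group"
begin

section \<open>Nonsymmetric topological operads\<close>

text \<open>
  Products are formed in the category of compactly generated Hausdorff spaces: the
  product carries the k-ification of the product topology.
\<close>

definition kification :: "'a topology \<Rightarrow> 'a topology" where
  "kification X = topology (\<lambda>U. U \<subseteq> topspace X \<and>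
     (\<forall>K. compactin X K \<longrightarrow> openin (subtopology X K) (K \<inter> U)))"

lemma openin_kification:
  "openin (kification X) U \<longleftrightarrow>
     U \<subseteq> topspace X \<and> (\<forall>K. compactin X K \<longrightarrow> openin (subtopology X K) (K \<inter> U))"
proof -
  let ?Q = "\<lambda>U. U \<subseteq> topspace X \<and>
     (\<forall>K. compactin X K \<longrightarrow> openin (subtopology X K) (K \<inter> U))"
  have inter: "?Q (S \<inter> T)" if "?Q S" "?Q T" for S T
  proof (intro conjI allI impI)
    show "S \<inter> T \<subseteq> topspace X" using that by blast
    fix K assume K: "compactin X K"
    have "K \<inter> (S \<inter> T) = (K \<inter> S) \<inter> (K \<inter> T)" by blast
    moreover have "openin (subtopology X K) ((K \<inter> S) \<inter> (K \<inter> T))"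
      by (rule openin_Int) (use that K in simp_all)
    ultimately show "openin (subtopology X K) (K \<inter> (S \<inter> T))" by (rule ssubst)
  qed
  have union: "?Q (\<Union>\<K>)" if "\<forall>S\<in>\<K>. ?Q S" for \<K>
  proof (intro conjI allI impI)
    show "\<Union>\<K> \<subseteq> topspace X" using that by blast
    fix K assume K: "compactin X K"
    have "K \<inter> \<Union>\<K> = \<Union>((\<inter>) K ` \<K>)" by blast
    moreover have "openin (subtopology X K) (\<Union>((\<inter>) K ` \<K>))"
      by (rule openin_Union) (use that K in auto)
    ultimately show "openin (subtopology X K) (K \<inter> \<Union>\<K>)" by (rule ssubst)
  qed
  have "istopology ?Q"
    unfolding istopology_def by (rule conjI; (rule allI)+; (rule impI)+; rule inter union)
  then show ?thesis
    unfolding kification_def by (rule fun_cong[OF topology_inverse'])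
qed

text \<open>
  The value \<open>op_comp P [m\<^sub>1, \<dots>, m\<^sub>k] a [b\<^sub>1, \<dots>, b\<^sub>k]\<close> is
  \<open>\<gamma>(a; b\<^sub>1, \<dots>, b\<^sub>k)\<close>. The list of arities is an argument because the spaces
  \<open>op_space P n\<close> need not be disjoint as sets.
\<close>

record 'a operad =
  op_space :: "nat \<Rightarrow> 'a topology"
  op_comp :: "nat list \<Rightarrow> 'a \<Rightarrow> 'a list \<Rightarrow> 'a"
  op_unit :: 'a

abbreviation op_pts :: "'a operad \<Rightarrow> nat \<Rightarrow> 'a set" where
  "op_pts P n \<equiv> topspace (op_space P n)"

definition op_args :: "'a operad \<Rightarrow> nat list \<Rightarrow> 'a list \<Rightarrow> bool" where
  "op_args P ms bs \<longleftrightarrow> list_all2 (\<lambda>m b. b \<in> op_pts P m) ms bs"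

definition op_dom :: "'a operad \<Rightarrow> nat list \<Rightarrow> ('a \<times> (nat \<Rightarrow> 'a)) topology" where
  "op_dom P ms = kification
     (prod_topology (op_space P (length ms))
        (product_topology (\<lambda>i. op_space P (ms ! i)) {..<length ms}))"

text \<open>
  The empty composition \<open>k = 0\<close> is included. It is the unique map from the point \<open>C(0)\<close> to
  itself, so it carries no data; it is the usual meaning of \<open>\<gamma>(b\<^sub>i; )\<close> in the
  associativity law when \<open>m\<^sub>i = 0\<close>.

  In the associativity law, \<open>nss\<close> lists the arities of the elements in \<open>css\<close>, grouped in
  blocks of lengths \<open>m\<^sub>1, \<dots>, m\<^sub>k\<close>.
\<close>

definition topological_operad :: "'a operad \<Rightarrow> bool" where
  "topological_operad P \<longleftrightarrow>
     (\<forall>n. k_space (op_space P n) \<and> Hausdorff_space (op_space P n)) \<and>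
     (\<exists>x. op_pts P 0 = {x}) \<and>
     (\<forall>ms. continuous_map (op_dom P ms) (op_space P (sum_list ms))
        (\<lambda>(a, b). op_comp P ms a (map b [0..<length ms]))) \<and>
     op_unit P \<in> op_pts P 1 \<and>
     (\<forall>nss a bs css. a \<in> op_pts P (length nss) \<and> op_args P (map length nss) bs \<and>
        list_all2 (op_args P) nss css \<longrightarrow>
        op_comp P (concat nss) (op_comp P (map length nss) a bs) (concat css) =
        op_comp P (map sum_list nss) a
          (map (\<lambda>i. op_comp P (nss ! i) (bs ! i) (css ! i)) [0..<length nss])) \<and>
     (\<forall>n. \<forall>a \<in> op_pts P n. op_comp P [n] (op_unit P) [a] = a) \<and>
     (\<forall>n. \<forall>a \<in> op_pts P n. op_comp P (replicate n 1) a (replicate n (op_unit P)) = a)"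

definition path_connected_operad :: "'a operad \<Rightarrow> bool" where
  "path_connected_operad P \<longleftrightarrow> (\<forall>n. path_connected_space (op_space P n))"

definition operad_morphism :: "'a operad \<Rightarrow> 'b operad \<Rightarrow> (nat \<Rightarrow> 'a \<Rightarrow> 'b) \<Rightarrow> bool" where
  "operad_morphism P Q \<phi> \<longleftrightarrow>
     (\<forall>n. continuous_map (op_space P n) (op_space Q n) (\<phi> n)) \<and>
     \<phi> 1 (op_unit P) = op_unit Q \<and>
     (\<forall>ms a bs. a \<in> op_pts P (length ms) \<and> op_args P ms bs \<longrightarrow>
        \<phi> (sum_list ms) (op_comp P ms a bs) =
        op_comp Q ms (\<phi> (length ms) a) (map2 \<phi> ms bs))"


section \<open>Group operads\<close>

text \<open>
  The symmetric group on \<open>{0, \<dots>, n - 1}\<close>. Products are read from left to right,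
  \<open>(aa')(i) = a'(a(i))\<close>: this is the convention under which the symmetric groups operad
  satisfies the interchange law \<open>\<gamma>(aa'; b\<^sub>i b'\<^sub>i) = \<gamma>(a; b\<^sub>i) \<gamma>(a'; b'\<^bsub>a\<^sup>-\<^sup>1(i)\<^esub>)\<close>
  required below.
\<close>

definition symmetric_group :: "nat \<Rightarrow> (nat \<Rightarrow> nat) monoid" where
  "symmetric_group n = \<lparr>carrier = {p. p permutes {..<n}}, mult = (\<lambda>p q. q \<circ> p), one = id\<rparr>"

text \<open>
  \<open>symmetric_comp [m\<^sub>0, \<dots>, m\<^bsub>k-1\<^esub>] \<sigma> [\<tau>\<^sub>0, \<dots>, \<tau>\<^bsub>k-1\<^esub>]\<close> applies \<open>\<tau>\<^sub>i\<close> inside the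
  \<open>i\<close>-th of \<open>k\<close> consecutive blocks of sizes \<open>m\<^sub>0, \<dots>, m\<^bsub>k-1\<^esub>\<close> and moves that block to
  position \<open>\<sigma>(i)\<close>.
\<close>

definition symmetric_comp ::
    "nat list \<Rightarrow> (nat \<Rightarrow> nat) \<Rightarrow> (nat \<Rightarrow> nat) list \<Rightarrow> (nat \<Rightarrow> nat)" where
  "symmetric_comp ms \<sigma> \<tau>s = (\<lambda>x.
     if x < sum_list ms then
       let i = (LEAST i. x < sum_list (take (Suc i) ms)); j = x - sum_list (take i ms)
       in (\<Sum>p \<in> {p. p < length ms \<and> \<sigma> p < \<sigma> i}. ms ! p) + (\<tau>s ! i) j
     else x)"

definition symmetric_operad :: "(nat \<Rightarrow> nat) operad" where
  "symmetric_operad =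
     \<lparr>op_space = (\<lambda>n. discrete_topology (carrier (symmetric_group n))),
      op_comp = symmetric_comp,
      op_unit = id\<rparr>"

definition operad_of_groups ::
    "(nat \<Rightarrow> 'g monoid) \<Rightarrow> (nat list \<Rightarrow> 'g \<Rightarrow> 'g list \<Rightarrow> 'g) \<Rightarrow> 'g operad" where
  "operad_of_groups G \<gamma> =
     \<lparr>op_space = (\<lambda>n. discrete_topology (carrier (G n))),
      op_comp = \<gamma>,
      op_unit = \<one>\<^bsub>G 1\<^esub>\<rparr>"

definition permute_list_by :: "(nat \<Rightarrow> nat) \<Rightarrow> 'b list \<Rightarrow> 'b list" where
  "permute_list_by \<sigma> xs = map (\<lambda>i. xs ! (inv_into UNIV \<sigma> i)) [0..<length xs]"

definition group_operad ::
    "(nat \<Rightarrow> 'g monoid) \<Rightarrow> (nat list \<Rightarrow> 'g \<Rightarrow> 'g list \<Rightarrow> 'g) \<Rightarrow> (nat \<Rightarrow> 'g \<Rightarrow> nat \<Rightarrow> nat) \<Rightarrow> bool"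
where
  "group_operad G \<gamma> \<pi> \<longleftrightarrow>
     topological_operad (operad_of_groups G \<gamma>) \<and>
     operad_morphism (operad_of_groups G \<gamma>) symmetric_operad \<pi> \<and>
     (\<forall>n. group (G n) \<and> \<pi> n \<in> hom (G n) (symmetric_group n)) \<and>
     (\<forall>ms a a' bs bs'.
        a \<in> carrier (G (length ms)) \<and> a' \<in> carrier (G (length ms)) \<and>
        list_all2 (\<lambda>m b. b \<in> carrier (G m)) ms bs \<and>
        list_all2 (\<lambda>m b. b \<in> carrier (G m)) ms bs' \<longrightarrow>
        \<gamma> ms (a \<otimes>\<^bsub>G (length ms)\<^esub> a')
          (map (\<lambda>i. bs ! i \<otimes>\<^bsub>G (ms ! i)\<^esub> bs' ! i) [0..<length ms]) =
        \<gamma> ms a bs \<otimes>\<^bsub>G (sum_list ms)\<^esub>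
        \<gamma> (permute_list_by (\<pi> (length ms) a) ms) a'
          (permute_list_by (\<pi> (length ms) a) bs'))"

definition noncrossed_group_operad ::
    "(nat \<Rightarrow> 'g monoid) \<Rightarrow> (nat list \<Rightarrow> 'g \<Rightarrow> 'g list \<Rightarrow> 'g) \<Rightarrow> (nat \<Rightarrow> 'g \<Rightarrow> nat \<Rightarrow> nat) \<Rightarrow> bool"
where
  "noncrossed_group_operad G \<gamma> \<pi> \<longleftrightarrow>
     group_operad G \<gamma> \<pi> \<and> (\<forall>n. \<forall>a \<in> carrier (G n). \<pi> n a = id)"


section \<open>The little intervals operad and good basepoints\<close>

text \<open>
  The pair \<open>(l, r)\<close> with \<open>0 \<le> l < r \<le> 1\<close> stands for the increasing affine embedding of
  \<open>[0, 1]\<close> into itself with image \<open>[l, r]\<close>.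
\<close>

definition affine_emb :: "real \<times> real \<Rightarrow> real \<Rightarrow> real" where
  "affine_emb p t = fst p + (snd p - fst p) * t"

definition emb_comp :: "real \<times> real \<Rightarrow> real \<times> real \<Rightarrow> real \<times> real" where
  "emb_comp p q = (affine_emb p (fst q), affine_emb p (snd q))"

lemma affine_emb_emb_comp: "affine_emb (emb_comp p q) = affine_emb p \<circ> affine_emb q"
  by (auto simp: affine_emb_def emb_comp_def fun_eq_iff algebra_simps)

definition little_interval_tuples :: "nat \<Rightarrow> (real \<times> real) list set" where
  "little_interval_tuples k = {u. length u = k \<and>
     (\<forall>p \<in> set u. 0 \<le> fst p \<and> fst p < snd p \<and> snd p \<le> 1) \<and>
     (\<forall>i < k. \<forall>j < k. i \<noteq> j \<longrightarrow>
        interior (affine_emb (u ! i) ` {0..1}) \<inter> interior (affine_emb (u ! j) ` {0..1}) = {})}"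

text \<open>
  An affine embedding depends linearly on its endpoints, so the uniform topology on tuples
  of embeddings is the Euclidean topology on the endpoints.
\<close>

definition little_intervals_space :: "nat \<Rightarrow> (real \<times> real) list topology" where
  "little_intervals_space k = pullback_topology (little_interval_tuples k)
     (\<lambda>u. \<lambda>i \<in> {..<k}. u ! i) (product_topology (\<lambda>_. euclidean) {..<k})"

definition std_intervals :: "nat \<Rightarrow> (real \<times> real) list" where
  "std_intervals k = map (\<lambda>i. (real i / real k, real (Suc i) / real k)) [0..<k]"

definition little_intervals_comp ::
    "nat list \<Rightarrow> (real \<times> real) list \<Rightarrow> (real \<times> real) list list \<Rightarrow> (real \<times> real) list" where
  "little_intervals_comp ms c ds = concat (map2 (\<lambda>p d. map (emb_comp p) d) c ds)"

definition little_intervals0 :: "(real \<times> real) list operad" where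
  "little_intervals0 =
     \<lparr>op_space = (\<lambda>k. subtopology (little_intervals_space k)
        (path_component_of_set (little_intervals_space k) (std_intervals k))),
      op_comp = little_intervals_comp,
      op_unit = [(0, 1)]\<rparr>"

text \<open>
  A good basepoint consists of the points \<open>e k\<close> together with the morphism \<open>\<eta>\<close> they come from;
  the linear paths depend on \<open>\<eta>\<close>.
\<close>

definition good_basepoint ::
    "'a operad \<Rightarrow> (nat \<Rightarrow> (real \<times> real) list \<Rightarrow> 'a) \<Rightarrow> (nat \<Rightarrow> 'a) \<Rightarrow> bool" where
  "good_basepoint P \<eta> e \<longleftrightarrow>
     operad_morphism little_intervals0 P \<eta> \<and> (\<forall>k. e k = \<eta> k (std_intervals k))"

definition linear_path ::
    "((real \<times> real) list \<Rightarrow> 'a) \<Rightarrow> (real \<times> real) list \<Rightarrow> (real \<times> real) list \<Rightarrow> real \<Rightarrow> 'a" where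
  "linear_path h u v = (\<lambda>t. h (map2 (\<lambda>p q. (1 - t) *\<^sub>R p + t *\<^sub>R q) u v))"

definition delta_path ::
    "(nat \<Rightarrow> (real \<times> real) list \<Rightarrow> 'a) \<Rightarrow> nat list \<Rightarrow> real \<Rightarrow> 'a" where
  "delta_path \<eta> ms = linear_path (\<eta> (sum_list ms)) (std_intervals (sum_list ms))
     (little_intervals_comp ms (std_intervals (length ms)) (map std_intervals ms))"


section \<open>Fundamental groups\<close>

text \<open>
  The concatenation \<open>+++\<close> and \<open>reversepath\<close> of the library require the
  points to form a type of class \<open>topological_space\<close>; here the space is an
  abstract topology. As for \<^const>\<open>pathin\<close>, the values of a path outside \<open>[0, 1]\<close> are
  irrelevant.
\<close>

definition path_join :: "(real \<Rightarrow> 'a) \<Rightarrow> (real \<Rightarrow> 'a) \<Rightarrow> real \<Rightarrow> 'a" where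
  "path_join f g = (\<lambda>t. if t \<le> 1/2 then f (2 * t) else g (2 * t - 1))"

definition path_reverse :: "(real \<Rightarrow> 'a) \<Rightarrow> real \<Rightarrow> 'a" where
  "path_reverse f = (\<lambda>t. f (1 - t))"

definition path_class :: "'a topology \<Rightarrow> (real \<Rightarrow> 'a) \<Rightarrow> (real \<Rightarrow> 'a) set" where
  "path_class X f =
     {g. homotopic_with (\<lambda>r. r 0 = f 0 \<and> r 1 = f 1) (top_of_set {0..1}) X f g}"

text \<open>
  Operations on classes take the union of the result classes over all representatives.
\<close>

definition class_mult ::
    "'a topology \<Rightarrow> (real \<Rightarrow> 'a) set \<Rightarrow> (real \<Rightarrow> 'a) set \<Rightarrow> (real \<Rightarrow> 'a) set" where
  "class_mult X A B = (\<Union>f \<in> A. \<Union>g \<in> B. path_class X (path_join f g))"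

definition class_inverse :: "'a topology \<Rightarrow> (real \<Rightarrow> 'a) set \<Rightarrow> (real \<Rightarrow> 'a) set" where
  "class_inverse X A = (\<Union>f \<in> A. path_class X (path_reverse f))"

definition loops :: "'a topology \<Rightarrow> 'a \<Rightarrow> (real \<Rightarrow> 'a) set" where
  "loops X x = {f. pathin X f \<and> f 0 = x \<and> f 1 = x}"

definition fundamental_group :: "'a topology \<Rightarrow> 'a \<Rightarrow> (real \<Rightarrow> 'a) set monoid" where
  "fundamental_group X x =
     \<lparr>carrier = path_class X ` loops X x,
      mult = class_mult X,
      one = path_class X (\<lambda>_. x)\<rparr>"

definition pi1_groups :: "'a operad \<Rightarrow> (nat \<Rightarrow> 'a) \<Rightarrow> nat \<Rightarrow> (real \<Rightarrow> 'a) set monoid" where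
  "pi1_groups P e n = fundamental_group (op_space P n) (e n)"

definition pointwise_comp ::
    "'a operad \<Rightarrow> nat list \<Rightarrow> (real \<Rightarrow> 'a) \<Rightarrow> (real \<Rightarrow> 'a) list \<Rightarrow> real \<Rightarrow> 'a" where
  "pointwise_comp P ms f gs = (\<lambda>z. op_comp P ms (f z) (map (\<lambda>g. g z) gs))"

definition conjugated_comp ::
    "'a operad \<Rightarrow> (nat \<Rightarrow> (real \<times> real) list \<Rightarrow> 'a) \<Rightarrow> nat list \<Rightarrow>
     (real \<Rightarrow> 'a) \<Rightarrow> (real \<Rightarrow> 'a) list \<Rightarrow> (real \<Rightarrow> 'a) set" where
  "conjugated_comp P \<eta> ms f gs =
     (let X = op_space P (sum_list ms); \<delta> = path_class X (delta_path \<eta> ms)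
      in class_mult X (class_mult X \<delta> (path_class X (pointwise_comp P ms f gs)))
           (class_inverse X \<delta>))"

definition pi1_comp ::
    "'a operad \<Rightarrow> (nat \<Rightarrow> (real \<times> real) list \<Rightarrow> 'a) \<Rightarrow> nat list \<Rightarrow>
     (real \<Rightarrow> 'a) set \<Rightarrow> (real \<Rightarrow> 'a) set list \<Rightarrow> (real \<Rightarrow> 'a) set" where
  "pi1_comp P \<eta> ms A Bs =
     (\<Union>f \<in> A. \<Union>gs \<in> {gs. list_all2 (\<lambda>B g. g \<in> B) Bs gs}. conjugated_comp P \<eta> ms f gs)"

end

theory Submission
  imports Defs
begin

text \<open>
  A loop \<open>f\<close> at \<open>e\<^sub>k\<close> and loops \<open>g\<^sub>i\<close> at \<open>e\<^bsub>m\<^sub>i\<^esub>\<close> have a pointwise composite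
  \<open>\<gamma>(f; g\<^sub>1, \<dots>, g\<^sub>k)\<close>, which is a loop at the wrong point
  \<open>\<gamma>(e\<^sub>k; e\<^bsub>m\<^sub>1\<^esub>, \<dots>, e\<^bsub>m\<^sub>k\<^esub>)\<close>; the linear path \<open>\<delta>\<close> transports it back to \<open>e\<^sub>m\<close>. Pointwise
  composition respects homotopies (\<open>path_homotopic_pointwise_comp\<close>) and commutes strictly with
  concatenation and reversal of paths. Hence the composition of classes is well defined
  (\<open>pi1_comp_eq\<close>), and it is a homomorphism (\<open>pi1_comp_mult\<close>), because conjugation by \<open>\<delta>\<close> is
  multiplicative.

  The point is associativity. Both bracketings of a triple composition are, up to homotopy, of the form
  \<open>D x D\<^sup>-\<^sup>1\<close>, where \<open>x\<close> is the pointwise triple composite, the same loop in both cases by associativity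
  in \<open>P\<close>, and where \<open>D\<close> is a concatenation of two paths: the outer \<open>\<delta>\<close>, followed by the operadic
  composite of the inner \<open>\<delta>\<close> or \<open>\<delta>\<close>s with constant paths at basepoints. To see this, one writes
  the arguments that are not conjugates already as conjugates by constant paths and composes factor by
  factor. It remains to compare the two paths \<open>D\<close>. Here the good basepoint enters. All
  paths \<open>\<delta>\<close> come from paths of interval tuples, and composition of affine embeddings is affine in each
  factor, so both halves of \<open>D\<close> are images of line segments
  (\<open>linear_path_comp_left\<close>, \<open>linear_path_comp_right\<close>). Left-to-right interval tuples form a
  convex set, so \<open>D\<close> is homotopic to the linear path between its endpoints
  (\<open>path_homotopic_join_linear_path\<close>), and the endpoints agree for the two bracketings by associativity
  of the little intervals operad (\<open>subdivision_assoc\<close>). This gives \<open>loop_comp_assoc\<close>. The unit laws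
  hold because \<open>\<delta>\<close> is constant there.

  Loops are handled through the relation of homotopy relative to the endpoints; the groupoid
  laws for it are all obtained by reparametrizing a single path
  (\<open>path_homotopic_reparametrize\<close>).
\<close>

section \<open>Path homotopy\<close>

text \<open>
  Homotopy relative to the endpoints; the classes of this relation are the sets
  \<^const>\<open>path_class\<close>. Working with the relation instead of the classes allows chains of
  homotopies.
\<close>

definition path_homotopic :: "'a topology \<Rightarrow> (real \<Rightarrow> 'a) \<Rightarrow> (real \<Rightarrow> 'a) \<Rightarrow> bool" where
  "path_homotopic X f g \<longleftrightarrow>
     homotopic_with (\<lambda>r. r 0 = f 0 \<and> r 1 = f 1) (top_of_set {0..1}) X f g"

abbreviation unit_square :: "(real \<times> real) set" where
  "unit_square \<equiv> {0..1} \<times> {0..1}"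

lemma path_class_eq_Collect: "path_class X f = {g. path_homotopic X f g}"
  by (simp add: path_class_def path_homotopic_def)

text \<open>
  The paths and the homotopy are arbitrary outside \<open>[0, 1]\<close>; the equations are therefore only demanded on
  the unit square.
\<close>

lemma path_homotopicI:
  assumes "continuous_map (top_of_set unit_square) X h"
    and "\<And>t. t \<in> {0..1} \<Longrightarrow> h (0, t) = f t"
    and "\<And>t. t \<in> {0..1} \<Longrightarrow> h (1, t) = g t"
    and "\<And>s. s \<in> {0..1} \<Longrightarrow> h (s, 0) = f 0"
    and "\<And>s. s \<in> {0..1} \<Longrightarrow> h (s, 1) = f 1"
  shows "path_homotopic X f g"
  unfolding path_homotopic_def
  by (subst homotopic_with)
    (use assms in \<open>auto simp: prod_topology_subtopology_eu intro!: exI[of _ h]\<close>)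

lemma path_homotopicE:
  assumes "path_homotopic X f g"
  obtains h where "continuous_map (top_of_set unit_square) X h"
    "\<And>t. h (0, t) = f t" "\<And>t. h (1, t) = g t"
    "\<And>s. s \<in> {0..1} \<Longrightarrow> h (s, 0) = f 0" "\<And>s. s \<in> {0..1} \<Longrightarrow> h (s, 1) = f 1"
  using assms unfolding path_homotopic_def homotopic_with_def
  by (auto simp: prod_topology_subtopology_eu)

lemma path_homotopic_endpoints:
  assumes "path_homotopic X f g"
  shows "pathin X f" "pathin X g" "g 0 = f 0" "g 1 = f 1"
  using homotopic_with_imp_continuous_maps[OF assms[unfolded path_homotopic_def]]
    homotopic_with_imp_property[OF assms[unfolded path_homotopic_def]]
  by (auto simp: pathin_def)

lemma pathin_in_topspace: "pathin X f \<Longrightarrow> t \<in> {0..1} \<Longrightarrow> f t \<in> topspace X"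
  by (auto simp: pathin_def continuous_map)

lemma path_homotopic_refl: "pathin X f \<Longrightarrow> path_homotopic X f f"
  by (simp add: path_homotopic_def pathin_def)

lemma path_homotopic_sym: "path_homotopic X f g \<Longrightarrow> path_homotopic X g f"
  using path_homotopic_endpoints[of X f g]
  by (simp add: path_homotopic_def homotopic_with_symD)

lemma path_homotopic_trans [trans]:
  "path_homotopic X f g \<Longrightarrow> path_homotopic X g h \<Longrightarrow> path_homotopic X f h"
  using path_homotopic_endpoints[of X f g]
  by (auto simp: path_homotopic_def intro: homotopic_with_trans)

lemma path_homotopic_eqI:
  assumes "pathin X f" "\<And>t. t \<in> {0..1} \<Longrightarrow> f t = g t"
  shows "path_homotopic X f g"
  unfolding path_homotopic_def
  by (rule homotopic_with_equal) (use assms in \<open>auto simp: pathin_def\<close>)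

lemma path_homotopic_compose:
  assumes "path_homotopic X f g" "continuous_map X Y k"
  shows "path_homotopic Y (k \<circ> f) (k \<circ> g)"
  using assms unfolding path_homotopic_def
  by (auto intro: homotopic_with_compose_continuous_map_left)

lemma path_class_eq_iff:
  "pathin X g \<Longrightarrow> path_class X f = path_class X g \<longleftrightarrow> path_homotopic X f g"
  unfolding path_class_eq_Collect
  using path_homotopic_refl path_homotopic_sym path_homotopic_trans by blast

lemma path_class_eqI: "path_homotopic X f g \<Longrightarrow> path_class X f = path_class X g"
  by (simp add: path_class_eq_iff path_homotopic_endpoints)

text \<open>
  The interval is convex, so two reparametrizations with the same endpoints are joined by the straight
  line between them. All the groupoid laws below are instances: each side of such a law is one and the
  same path, travelled along by two different piecewise linear functions.
\<close>

lemma path_homotopic_reparametrize: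
  assumes f: "pathin X f"
    and "continuous_on {0..1} p" "p ` {0..1} \<subseteq> {0..1}"
    and "continuous_on {0..1} q" "q ` {0..1} \<subseteq> {0..1}"
    and "p 0 = q 0" "p 1 = q 1"
  shows "path_homotopic X (f \<circ> p) (f \<circ> q)"
proof -
  let ?h = "\<lambda>(s, t). (1 - s) * p t + s * q t"
  have "continuous_on unit_square (\<lambda>x. p (snd x))" "continuous_on unit_square (\<lambda>x. q (snd x))"
    by (rule continuous_on_compose2[OF assms(2)] continuous_on_compose2[OF assms(4)];
        force intro: continuous_intros)+
  then have 1: "continuous_on unit_square ?h"
    unfolding case_prod_unfold by (intro continuous_intros)
  have "?h (s, t) \<in> {0..1}" if "s \<in> {0..1}" "t \<in> {0..1}" for s t
  proof -
    have "p t \<in> {0..1}" "q t \<in> {0..1}" using assms(3,5) that by blast+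
    then have "(1 - s) *\<^sub>R p t + s *\<^sub>R q t \<in> {0..1}"
      using that by (intro convexD[OF convex_real_interval(5)]) auto
    then show ?thesis by simp
  qed
  then have "continuous_map (top_of_set unit_square) (top_of_set {0..1}) ?h"
    using 1 by (auto simp: continuous_map_subtopology_eu)
  from continuous_map_compose[OF this f[unfolded pathin_def]]
  show ?thesis
    by (rule path_homotopicI) (use assms in \<open>auto simp: algebra_simps\<close>)
qed

lemma path_homotopic_join:
  assumes "path_homotopic X f f'" "path_homotopic X g g'" "f 1 = g 0"
  shows "path_homotopic X (path_join f g) (path_join f' g')"
proof -
  obtain h where h: "continuous_map (top_of_set unit_square) X h"
    "\<And>t. h (0, t) = f t" "\<And>t. h (1, t) = f' t"
    "\<And>s. s \<in> {0..1} \<Longrightarrow> h (s, 0) = f 0" "\<And>s. s \<in> {0..1} \<Longrightarrow> h (s, 1) = f 1"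
    using path_homotopicE[OF assms(1)] by metis
  obtain k where k: "continuous_map (top_of_set unit_square) X k"
    "\<And>t. k (0, t) = g t" "\<And>t. k (1, t) = g' t"
    "\<And>s. s \<in> {0..1} \<Longrightarrow> k (s, 0) = g 0" "\<And>s. s \<in> {0..1} \<Longrightarrow> k (s, 1) = g 1"
    using path_homotopicE[OF assms(2)] by metis
  let ?H = "\<lambda>x. if snd x \<le> 1/2 then (h \<circ> (\<lambda>x. (fst x, 2 * snd x))) x
                 else (k \<circ> (\<lambda>x. (fst x, 2 * snd x - 1))) x"
  have "continuous_map (top_of_set unit_square) X ?H"
  proof (rule continuous_map_cases_le)
    show "continuous_map (top_of_set unit_square) euclideanreal snd"
      "continuous_map (top_of_set unit_square) euclideanreal (\<lambda>_. 1/2)"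
      by (auto intro: continuous_intros)
    show "continuous_map (subtopology (top_of_set unit_square)
        {x \<in> topspace (top_of_set unit_square). snd x \<le> 1/2}) X (h \<circ> (\<lambda>x. (fst x, 2 * snd x)))"
      by (rule continuous_map_compose[OF _ h(1)])
        (auto simp: subtopology_subtopology continuous_map_subtopology_eu intro!: continuous_intros)
    show "continuous_map (subtopology (top_of_set unit_square)
        {x \<in> topspace (top_of_set unit_square). 1/2 \<le> snd x}) X (k \<circ> (\<lambda>x. (fst x, 2 * snd x - 1)))"
      by (rule continuous_map_compose[OF _ k(1)])
        (auto simp: subtopology_subtopology continuous_map_subtopology_eu intro!: continuous_intros)
    show "\<And>x. x \<in> topspace (top_of_set unit_square) \<Longrightarrow> snd x = 1/2 \<Longrightarrow>
       (h \<circ> (\<lambda>x. (fst x, 2 * snd x))) x = (k \<circ> (\<lambda>x. (fst x, 2 * snd x - 1))) x"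
    proof -
      fix x assume x: "x \<in> topspace (top_of_set unit_square)" "snd x = 1/2"
      then have "2 * snd x = 1" "2 * snd x - 1 = 0" "fst x \<in> {0..1}" by auto
      then show "(h \<circ> (\<lambda>x. (fst x, 2 * snd x))) x = (k \<circ> (\<lambda>x. (fst x, 2 * snd x - 1))) x"
        using h(5) k(4) assms(3) by (simp only: o_def)
    qed
  qed
  then show ?thesis
    by (rule path_homotopicI) (auto simp: path_join_def h k)
qed

lemma pathin_join: "pathin X f \<Longrightarrow> pathin X g \<Longrightarrow> f 1 = g 0 \<Longrightarrow> pathin X (path_join f g)"
  by (meson path_homotopic_endpoints(1) path_homotopic_join path_homotopic_refl)

lemma path_join_endpoints [simp]: "path_join f g 0 = f 0" "path_join f g 1 = g 1"
  by (simp_all add: path_join_def)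

lemma path_reverse_endpoints [simp]: "path_reverse f 0 = f 1" "path_reverse f 1 = f 0"
  by (simp_all add: path_reverse_def)

lemma path_homotopic_reverse:
  assumes "path_homotopic X f g"
  shows "path_homotopic X (path_reverse f) (path_reverse g)"
proof -
  obtain h where h: "continuous_map (top_of_set unit_square) X h"
    "\<And>t. h (0, t) = f t" "\<And>t. h (1, t) = g t"
    "\<And>s. s \<in> {0..1} \<Longrightarrow> h (s, 0) = f 0" "\<And>s. s \<in> {0..1} \<Longrightarrow> h (s, 1) = f 1"
    using path_homotopicE[OF assms] by metis
  have "continuous_map (top_of_set unit_square) X (h \<circ> (\<lambda>x. (fst x, 1 - snd x)))"
    by (rule continuous_map_compose[OF _ h(1)])
      (auto simp: continuous_map_subtopology_eu intro!: continuous_intros)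
  then show ?thesis
    by (rule path_homotopicI) (auto simp: path_reverse_def h)
qed

lemma pathin_reverse: "pathin X f \<Longrightarrow> pathin X (path_reverse f)"
  by (meson path_homotopic_endpoints(1) path_homotopic_reverse path_homotopic_refl)

lemma path_homotopic_join_assoc:
  assumes "pathin X f" "pathin X g" "pathin X h" "f 1 = g 0" "g 1 = h 0"
  shows "path_homotopic X (path_join (path_join f g) h) (path_join f (path_join g h))"
proof -
  let ?k = "path_join (path_join f g) h"
  \<comment> \<open>The change of parameter has slopes \<open>1/2\<close>, \<open>1\<close>, \<open>2\<close> with breaks at \<open>1/2\<close> and \<open>3/4\<close>;
    being convex, it is the maximum of its three linear pieces.\<close>
  let ?q = "\<lambda>t::real. max (t / 2) (max (t - 1/4) (2 * t - 1))"
  have "path_homotopic X (?k \<circ> (\<lambda>t. t)) (?k \<circ> ?q)"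
    by (rule path_homotopic_reparametrize)
      (use assms in \<open>auto simp: le_max_iff_disj intro!: pathin_join continuous_intros\<close>)
  also have "?k \<circ> ?q = path_join f (path_join g h)"
  proof
    fix t :: real
    consider "t \<le> 1/2" | "1/2 < t" "t \<le> 3/4" | "3/4 < t" by linarith
    then show "(?k \<circ> ?q) t = path_join f (path_join g h) t"
    proof cases
      case 1
      then have "?q t = t / 2" by (simp add: max_def)
      then show ?thesis using 1 by (simp add: path_join_def)
    next
      case 2
      then have "?q t = t - 1/4" "2 * (2 * (t - 1/4)) - 1 = 2 * (2 * t - 1)"
        by (auto simp: max_def)
      moreover have "\<not> 2 * (t - 1/4) \<le> 1/2" "t - 1/4 \<le> 1/2" "\<not> t \<le> 1/2" "2 * t - 1 \<le> 1/2"
        using 2 by auto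
      ultimately show ?thesis unfolding path_join_def o_def by (simp only: if_True if_False)
    next
      case 3
      then have "?q t = 2 * t - 1" by (simp add: max_def)
      then show ?thesis using 3 by (simp add: path_join_def)
    qed
  qed
  finally show ?thesis by (simp add: o_def)
qed

lemma path_homotopic_join_const_right:
  assumes "pathin X f"
  shows "path_homotopic X (path_join f (\<lambda>_. f 1)) f"
proof -
  have "path_homotopic X (f \<circ> (\<lambda>t. min (2 * t) 1)) (f \<circ> (\<lambda>t. t))"
    by (rule path_homotopic_reparametrize) (use assms in \<open>auto intro!: continuous_intros\<close>)
  also have "f \<circ> (\<lambda>t. min (2 * t) 1) = path_join f (\<lambda>_. f 1)"
    by (auto simp: path_join_def fun_eq_iff min_def field_simps)
  finally show ?thesis by (simp add: o_def)
qed

lemma path_homotopic_join_const_left: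
  assumes "pathin X f"
  shows "path_homotopic X (path_join (\<lambda>_. f 0) f) f"
proof -
  have "path_homotopic X (f \<circ> (\<lambda>t. max 0 (2 * t - 1))) (f \<circ> (\<lambda>t. t))"
    by (rule path_homotopic_reparametrize) (use assms in \<open>auto intro!: continuous_intros\<close>)
  also have "f \<circ> (\<lambda>t. max 0 (2 * t - 1)) = path_join (\<lambda>_. f 0) f"
    by (auto simp: path_join_def fun_eq_iff max_def field_simps)
  finally show ?thesis by (simp add: o_def)
qed

lemma path_homotopic_join_reverse_right:
  assumes "pathin X f"
  shows "path_homotopic X (path_join f (path_reverse f)) (\<lambda>_. f 0)"
proof -
  \<comment> \<open>Going along \<open>f\<close> and back is \<open>f\<close> reparametrized by the tent function.\<close>
  have "path_homotopic X (f \<circ> (\<lambda>t. min (2 * t) (2 - 2 * t))) (f \<circ> (\<lambda>_. 0))"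
    by (rule path_homotopic_reparametrize) (use assms in \<open>auto intro!: continuous_intros\<close>)
  also have "f \<circ> (\<lambda>t. min (2 * t) (2 - 2 * t)) = path_join f (path_reverse f)"
    by (auto simp: path_join_def path_reverse_def fun_eq_iff min_def field_simps)
  finally show ?thesis by (simp add: o_def)
qed

lemma path_reverse_reverse [simp]: "path_reverse (path_reverse f) = f"
  by (simp add: path_reverse_def)

lemma path_homotopic_join_reverse_left:
  "pathin X f \<Longrightarrow> path_homotopic X (path_join (path_reverse f) f) (\<lambda>_. f 1)"
  using path_homotopic_join_reverse_right[OF pathin_reverse, of X f] by simp

lemma path_reverse_join:
  assumes "f 1 = g 0"
  shows "path_reverse (path_join f g) = path_join (path_reverse g) (path_reverse f)"
proof
  fix t :: real
  consider "t < 1/2" | "t = 1/2" | "t > 1/2" by linarith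
  then show "path_reverse (path_join f g) t = path_join (path_reverse g) (path_reverse f) t"
    using assms by cases (auto simp: path_reverse_def path_join_def algebra_simps)
qed

section \<open>Conjugation by a path\<close>

definition conjugate_path :: "(real \<Rightarrow> 'a) \<Rightarrow> (real \<Rightarrow> 'a) \<Rightarrow> real \<Rightarrow> 'a" where
  "conjugate_path \<delta> f = path_join (path_join \<delta> f) (path_reverse \<delta>)"

lemma conjugate_path_endpoints [simp]:
  "conjugate_path \<delta> f 0 = \<delta> 0" "conjugate_path \<delta> f 1 = \<delta> 0"
  by (simp_all add: conjugate_path_def)

lemma path_homotopic_conjugate:
  assumes "path_homotopic X \<delta> \<delta>'" "path_homotopic X f f'" "\<delta> 1 = f 0" "f 1 = f 0"
  shows "path_homotopic X (conjugate_path \<delta> f) (conjugate_path \<delta>' f')"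
  unfolding conjugate_path_def
  by (intro path_homotopic_join path_homotopic_reverse) (use assms in auto)

lemma pathin_conjugate:
  "pathin X \<delta> \<Longrightarrow> pathin X f \<Longrightarrow> \<delta> 1 = f 0 \<Longrightarrow> f 1 = f 0 \<Longrightarrow> pathin X (conjugate_path \<delta> f)"
  by (simp add: conjugate_path_def pathin_join pathin_reverse)

text \<open>
  Padding a loop with constant paths on both sides is harmless. This gives every argument of an operadic
  composition the form of a conjugate, so that the composition can be taken factor by factor.
\<close>

lemma path_homotopic_conjugate_const:
  assumes "pathin X f" "f 0 = x" "f 1 = x"
  shows "path_homotopic X (conjugate_path (\<lambda>_. x) f) f"
proof -
  have "path_homotopic X (conjugate_path (\<lambda>_. x) f) (path_join f (\<lambda>_. x))"
    unfolding conjugate_path_def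
    by (rule path_homotopic_join)
      (use assms path_homotopic_join_const_left[of X f] path_start_in_topspace[of X f] in
        \<open>auto simp: path_reverse_def intro: path_homotopic_refl\<close>)
  also have "path_homotopic X \<dots> f"
    using path_homotopic_join_const_right[OF assms(1)] assms by simp
  finally show ?thesis .
qed

lemma path_homotopic_conjugate_conjugate:
  assumes "pathin X \<delta>" "pathin X \<epsilon>" "pathin X f" "\<delta> 1 = \<epsilon> 0" "\<epsilon> 1 = f 0" "f 1 = f 0"
  shows "path_homotopic X (conjugate_path \<delta> (conjugate_path \<epsilon> f))
           (conjugate_path (path_join \<delta> \<epsilon>) f)"
proof -
  note [simp] = assms pathin_join pathin_reverse path_homotopic_refl
  have "path_homotopic X (conjugate_path \<delta> (conjugate_path \<epsilon> f))
      (path_join (path_join (path_join \<delta> (path_join \<epsilon> f)) (path_reverse \<epsilon>)) (path_reverse \<delta>))"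
    unfolding conjugate_path_def
    by (intro path_homotopic_join path_homotopic_sym[OF path_homotopic_join_assoc]) auto
  also have "path_homotopic X \<dots>
      (path_join (path_join (path_join (path_join \<delta> \<epsilon>) f) (path_reverse \<epsilon>)) (path_reverse \<delta>))"
    by (intro path_homotopic_join path_homotopic_sym[OF path_homotopic_join_assoc]) auto
  also have "path_homotopic X \<dots>
      (path_join (path_join (path_join \<delta> \<epsilon>) f) (path_join (path_reverse \<epsilon>) (path_reverse \<delta>)))"
    by (intro path_homotopic_join_assoc) auto
  finally show ?thesis by (simp add: conjugate_path_def path_reverse_join)
qed

text \<open>
  Conjugation is multiplicative because the inner \<open>\<delta>\<^sup>-\<^sup>1 \<delta>\<close> cancels. This is the source of the
  interchange law for the composition of homotopy classes.
\<close>

lemma path_homotopic_conjugate_join: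
  assumes "pathin X \<delta>" "pathin X f" "pathin X g"
    and "f 0 = \<delta> 1" "f 1 = \<delta> 1" "g 0 = \<delta> 1" "g 1 = \<delta> 1"
  shows "path_homotopic X (path_join (conjugate_path \<delta> f) (conjugate_path \<delta> g))
           (conjugate_path \<delta> (path_join f g))"
proof -
  note [simp] = assms pathin_join pathin_reverse path_homotopic_refl
  let ?r = "path_reverse \<delta>"
  have cancel: "path_homotopic X (path_join ?r (path_join \<delta> g)) g"
  proof -
    have "path_homotopic X (path_join ?r (path_join \<delta> g)) (path_join (path_join ?r \<delta>) g)"
      by (rule path_homotopic_sym[OF path_homotopic_join_assoc]) auto
    also have "path_homotopic X \<dots> (path_join (\<lambda>_. g 0) g)"
      by (rule path_homotopic_join) (use path_homotopic_join_reverse_left[of X \<delta>] in auto)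
    also have "path_homotopic X \<dots> g"
      by (rule path_homotopic_join_const_left) simp
    finally show ?thesis .
  qed
  have "path_homotopic X (path_join (conjugate_path \<delta> f) (conjugate_path \<delta> g))
      (path_join (path_join \<delta> f) (path_join ?r (path_join (path_join \<delta> g) ?r)))"
    unfolding conjugate_path_def by (rule path_homotopic_join_assoc) auto
  also have "path_homotopic X \<dots>
      (path_join (path_join \<delta> f) (path_join (path_join ?r (path_join \<delta> g)) ?r))"
    by (intro path_homotopic_join path_homotopic_sym[OF path_homotopic_join_assoc]) auto
  also have "path_homotopic X \<dots> (path_join (path_join \<delta> f) (path_join g ?r))"
    by (intro path_homotopic_join cancel) auto
  also have "path_homotopic X \<dots> (path_join (path_join (path_join \<delta> f) g) ?r)"
    by (rule path_homotopic_sym[OF path_homotopic_join_assoc]) auto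
  also have "path_homotopic X \<dots> (conjugate_path \<delta> (path_join f g))"
    unfolding conjugate_path_def by (intro path_homotopic_join path_homotopic_join_assoc) auto
  finally show ?thesis .
qed

section \<open>The fundamental group\<close>

lemma class_mult_path_class:
  assumes "pathin X f" "pathin X g" "f 1 = g 0"
  shows "class_mult X (path_class X f) (path_class X g) = path_class X (path_join f g)"
proof -
  have "path_class X (path_join f' g') = path_class X (path_join f g)"
    if "f' \<in> path_class X f" "g' \<in> path_class X g" for f' g'
    using that assms path_class_eqI[OF path_homotopic_join[of X f f' g g']]
    by (simp add: path_class_eq_Collect)
  moreover have "f \<in> path_class X f" "g \<in> path_class X g"
    using assms by (auto simp: path_class_eq_Collect path_homotopic_refl)
  ultimately show ?thesis unfolding class_mult_def by blast
qed

lemma class_inverse_path_class: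
  assumes "pathin X f"
  shows "class_inverse X (path_class X f) = path_class X (path_reverse f)"
proof -
  have "path_class X (path_reverse f') = path_class X (path_reverse f)"
    if "f' \<in> path_class X f" for f'
    using that path_class_eqI[OF path_homotopic_reverse[of X f f']]
    by (simp add: path_class_eq_Collect)
  moreover have "f \<in> path_class X f"
    using assms by (auto simp: path_class_eq_Collect path_homotopic_refl)
  ultimately show ?thesis unfolding class_inverse_def by blast
qed

lemma loops_const: "x \<in> topspace X \<Longrightarrow> (\<lambda>_. x) \<in> loops X x"
  by (simp add: loops_def)

lemma loops_join: "f \<in> loops X x \<Longrightarrow> g \<in> loops X x \<Longrightarrow> path_join f g \<in> loops X x"
  by (simp add: loops_def pathin_join)

lemma loops_reverse: "f \<in> loops X x \<Longrightarrow> path_reverse f \<in> loops X x"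
  by (simp add: loops_def pathin_reverse)

lemma loops_path_homotopic:
  "f \<in> loops X x \<Longrightarrow> path_homotopic X f g \<Longrightarrow> g \<in> loops X x"
  using path_homotopic_endpoints[of X f g] by (auto simp: loops_def)

lemma group_fundamental_group:
  assumes x: "x \<in> topspace X"
  shows "group (fundamental_group X x)"
proof (rule groupI; clarsimp simp: fundamental_group_def)
  fix f g assume fg: "f \<in> loops X x" "g \<in> loops X x"
  then have "class_mult X (path_class X f) (path_class X g) = path_class X (path_join f g)"
    by (intro class_mult_path_class) (auto simp: loops_def)
  then show "class_mult X (path_class X f) (path_class X g) \<in> path_class X ` loops X x"
    using loops_join[OF fg] by auto
next
  show "path_class X (\<lambda>_. x) \<in> path_class X ` loops X x"
    using loops_const[OF x] by auto
next
  fix f g h assume "f \<in> loops X x" "g \<in> loops X x" "h \<in> loops X x"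
  then show "class_mult X (class_mult X (path_class X f) (path_class X g)) (path_class X h) =
     class_mult X (path_class X f) (class_mult X (path_class X g) (path_class X h))"
    by (simp add: loops_def class_mult_path_class pathin_join path_class_eqI
        path_homotopic_join_assoc)
next
  fix f assume "f \<in> loops X x"
  then have f: "pathin X f" "f 0 = x" "f 1 = x" by (auto simp: loops_def)
  show "class_mult X (path_class X (\<lambda>_. x)) (path_class X f) = path_class X f"
    using path_homotopic_join_const_left[OF f(1)] f x
    by (simp add: class_mult_path_class path_class_eqI)
next
  fix f assume l: "f \<in> loops X x"
  then have f: "pathin X f" "f 0 = x" "f 1 = x" by (auto simp: loops_def)
  have "class_mult X (path_class X (path_reverse f)) (path_class X f) = path_class X (\<lambda>_. x)"
    using path_homotopic_join_reverse_left[OF f(1)] f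
    by (simp add: class_mult_path_class path_class_eqI pathin_reverse)
  then show "\<exists>y\<in>loops X x. class_mult X (path_class X y) (path_class X f) = path_class X (\<lambda>_. x)"
    using loops_reverse[OF l] by blast
qed

section \<open>Convexity of ordered interval configurations\<close>

text \<open>
  The tuples of intervals listed from left to right. They form a convex set of endpoint vectors, which
  is why linear paths stay inside and why all paths with the same endpoints are homotopic there. The
  order relation in \<open>sorted_wrt\<close> is required of all pairs \<open>i < j\<close>, not only of neighbours, and
  thus makes the interiors disjoint at once.
\<close>

definition ordered_intervals :: "nat \<Rightarrow> (real \<times> real) list set" where
  "ordered_intervals n = {u. length u = n \<and>
     (\<forall>p \<in> set u. 0 \<le> fst p \<and> fst p < snd p \<and> snd p \<le> 1) \<and>
     sorted_wrt (\<lambda>p q. snd p \<le> fst q) u}"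

abbreviation ordered_intervals_space :: "nat \<Rightarrow> (real \<times> real) list topology" where
  "ordered_intervals_space n \<equiv> subtopology (little_intervals_space n) (ordered_intervals n)"

text \<open>
  The linear path in the space of interval tuples itself; its image under \<open>\<eta>\<close> is
  \<^const>\<open>linear_path\<close>.
\<close>

definition segment :: "(real \<times> real) list \<Rightarrow> (real \<times> real) list \<Rightarrow> real \<Rightarrow> (real \<times> real) list"
  where "segment u v t = map2 (\<lambda>p q. (1 - t) *\<^sub>R p + t *\<^sub>R q) u v"

lemma linear_path_eq_segment: "linear_path h u v = h \<circ> segment u v"
  by (simp add: linear_path_def segment_def o_def)

lemma length_segment [simp]: "length (segment u v t) = min (length u) (length v)"
  by (simp add: segment_def)

lemma nth_segment:
  "i < length u \<Longrightarrow> i < length v \<Longrightarrow> segment u v t ! i = (1 - t) *\<^sub>R (u ! i) + t *\<^sub>R (v ! i)"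
  by (simp add: segment_def)

lemma segment_0 [simp]: "length u = length v \<Longrightarrow> segment u v 0 = u"
  by (rule nth_equalityI) (auto simp: nth_segment)

lemma segment_1 [simp]: "length u = length v \<Longrightarrow> segment u v 1 = v"
  by (rule nth_equalityI) (auto simp: nth_segment)

lemma segment_same [simp]: "segment u u t = u"
  by (rule nth_equalityI) (auto simp: nth_segment simp flip: scaleR_left_distrib)

lemma length_ordered_intervals: "u \<in> ordered_intervals n \<Longrightarrow> length u = n"
  by (simp add: ordered_intervals_def)

lemma ordered_intervals_nth:
  "u \<in> ordered_intervals n \<longleftrightarrow> length u = n \<and>
     (\<forall>i<n. 0 \<le> fst (u ! i) \<and> fst (u ! i) < snd (u ! i) \<and> snd (u ! i) \<le> 1) \<and>
     (\<forall>i j. i < j \<longrightarrow> j < n \<longrightarrow> snd (u ! i) \<le> fst (u ! j))"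
  unfolding ordered_intervals_def
  by (auto simp: sorted_wrt_iff_nth_less in_set_conv_nth all_set_conv_all_nth)

text \<open>
  All defining inequalities are linear in the endpoints, hence preserved by convex combinations; only
  the strict one, \<open>fst p < snd p\<close>, needs a case distinction, since one of the two weights may vanish.
\<close>

lemma segment_in_ordered_intervals:
  assumes u: "u \<in> ordered_intervals n" and v: "v \<in> ordered_intervals n" and t: "t \<in> {0..1}"
  shows "segment u v t \<in> ordered_intervals n"
  unfolding ordered_intervals_nth
proof (intro conjI allI impI)
  have len: "length u = n" "length v = n"
    using u v by (auto dest: length_ordered_intervals)
  then show "length (segment u v t) = n" by simp
  fix i assume i: "i < n"
  have ui: "0 \<le> fst (u ! i)" "fst (u ! i) < snd (u ! i)" "snd (u ! i) \<le> 1"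
    and vi: "0 \<le> fst (v ! i)" "fst (v ! i) < snd (v ! i)" "snd (v ! i) \<le> 1"
    using u v i by (auto simp: ordered_intervals_nth)
  show "0 \<le> fst (segment u v t ! i)"
    using t ui vi i len by (auto simp: nth_segment)
  show "snd (segment u v t ! i) \<le> 1"
    using t ui vi i len by (auto simp: nth_segment intro!: convex_bound_le)
  have "0 < (1 - t) * (snd (u ! i) - fst (u ! i)) + t * (snd (v ! i) - fst (v ! i))"
  proof (cases "t = 0")
    case False
    then show ?thesis using t ui vi by (intro add_nonneg_pos mult_nonneg_nonneg mult_pos_pos) auto
  qed (use ui in auto)
  then show "fst (segment u v t ! i) < snd (segment u v t ! i)"
    using i len by (simp add: nth_segment algebra_simps)
next
  fix i j assume ij: "i < j" "j < n"
  have "snd (u ! i) \<le> fst (u ! j)" "snd (v ! i) \<le> fst (v ! j)"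
    using u v ij by (auto simp: ordered_intervals_nth)
  then show "snd (segment u v t ! i) \<le> fst (segment u v t ! j)"
    using t ij length_ordered_intervals[OF u] length_ordered_intervals[OF v]
    by (auto simp: nth_segment intro!: add_mono mult_left_mono)
qed

lemma std_intervals_ordered: "std_intervals n \<in> ordered_intervals n"
  unfolding ordered_intervals_nth std_intervals_def
  by (auto simp: divide_simps)

lemma ordered_intervals_subset_tuples: "ordered_intervals n \<subseteq> little_interval_tuples n"
proof
  fix u assume u: "u \<in> ordered_intervals n"
  have len: "length u = n" using u by (rule length_ordered_intervals)
  have img: "affine_emb p ` {0..1} = {fst p..snd p}" if "fst p < snd p" for p
    using that image_affinity_atLeastAtMost[of "snd p - fst p" "fst p" 0 1]
    by (simp add: affine_emb_def [abs_def] add.commute)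
  have *: "interior (affine_emb (u ! i) ` {0..1}) \<inter> interior (affine_emb (u ! j) ` {0..1}) = {}"
    if "i < j" "j < n" for i j
  proof -
    have "fst (u ! i) < snd (u ! i)" "fst (u ! j) < snd (u ! j)" "snd (u ! i) \<le> fst (u ! j)"
      using u that by (auto simp: ordered_intervals_nth)
    then show ?thesis by (auto simp: img interior_atLeastAtMost_real)
  qed
  have "interior (affine_emb (u ! i) ` {0..1}) \<inter> interior (affine_emb (u ! j) ` {0..1}) = {}"
    if "i < n" "j < n" "i \<noteq> j" for i j
    using *[of i j] *[of j i] that by (cases "i < j") (auto simp: Int_commute)
  then show "u \<in> little_interval_tuples n"
    using u len unfolding little_interval_tuples_def ordered_intervals_def by blast
qed

lemma topspace_little_intervals_space:
  "topspace (little_intervals_space n) = little_interval_tuples n"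
  by (auto simp: little_intervals_space_def topspace_pullback_topology)

text \<open>
  Continuity into the space of tuples is continuity of the coordinates.
\<close>

lemma continuous_map_into_little_intervals_space:
  assumes "\<And>z. z \<in> topspace Z \<Longrightarrow> F z \<in> little_interval_tuples n"
    and "\<And>i. i < n \<Longrightarrow> continuous_map Z euclidean (\<lambda>z. F z ! i)"
  shows "continuous_map Z (little_intervals_space n) F"
  unfolding little_intervals_space_def
proof (rule continuous_map_pullback')
  show "continuous_map Z (product_topology (\<lambda>_. euclidean) {..<n}) ((\<lambda>u. \<lambda>i\<in>{..<n}. u ! i) \<circ> F)"
    using assms(2) by (auto simp: continuous_map_componentwise)
  show "topspace Z \<subseteq> F -` little_interval_tuples n"
    using assms(1) by auto
qed

lemma continuous_map_little_intervals_nth: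
  assumes "i < n"
  shows "continuous_map (little_intervals_space n) euclidean (\<lambda>u. u ! i)"
proof -
  have "continuous_map (product_topology (\<lambda>_. euclidean :: (real \<times> real) topology) {..<n})
      euclidean (\<lambda>x. x i)"
    using assms by (intro continuous_map_product_projection) auto
  from continuous_map_pullback[OF this, of "little_interval_tuples n" "\<lambda>u. \<lambda>i\<in>{..<n}. u ! i"]
  show ?thesis using assms by (simp add: little_intervals_space_def o_def)
qed

lemma continuous_map_segment:
  assumes S: "s \<in> topspace Z \<rightarrow> {0..1}" "continuous_map Z euclideanreal s"
    and f: "continuous_map Z (ordered_intervals_space n) f"
    and g: "continuous_map Z (ordered_intervals_space n) g"
  shows "continuous_map Z (ordered_intervals_space n) (\<lambda>z. segment (f z) (g z) (s z))"
proof -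
  have fg: "f z \<in> ordered_intervals n" "g z \<in> ordered_intervals n" if "z \<in> topspace Z" for z
    using f g that by (auto simp: continuous_map_in_subtopology)
  then have ord: "segment (f z) (g z) (s z) \<in> ordered_intervals n" if "z \<in> topspace Z" for z
    using S(1) that by (intro segment_in_ordered_intervals) auto
  have coord: "continuous_map Z euclidean (\<lambda>z. h z ! i)"
    if "i < n" "continuous_map Z (ordered_intervals_space n) h" for h i
    using continuous_map_compose[OF _ continuous_map_little_intervals_nth[OF that(1)], of Z h] that
    by (auto simp: continuous_map_in_subtopology o_def)
  have "continuous_map Z (little_intervals_space n) (\<lambda>z. segment (f z) (g z) (s z))"
  proof (rule continuous_map_into_little_intervals_space)
    show "\<And>z. z \<in> topspace Z \<Longrightarrow> segment (f z) (g z) (s z) \<in> little_interval_tuples n"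
      using ord ordered_intervals_subset_tuples by blast
    fix i assume i: "i < n"
    have "continuous_map Z euclidean (\<lambda>z. (1 - s z) *\<^sub>R (f z ! i) + s z *\<^sub>R (g z ! i))"
      using S(2) coord[OF i f] coord[OF i g]
      by (auto simp: continuous_map_atin intro!: tendsto_intros)
    then show "continuous_map Z euclidean (\<lambda>z. segment (f z) (g z) (s z) ! i)"
      by (rule continuous_map_eq)
        (use i length_ordered_intervals[OF fg(1)] length_ordered_intervals[OF fg(2)] in
          \<open>simp add: nth_segment\<close>)
  qed
  then show ?thesis
    using ord by (auto simp: continuous_map_in_subtopology)
qed

lemma topspace_ordered_intervals_space:
  "topspace (ordered_intervals_space n) = ordered_intervals n"
  using ordered_intervals_subset_tuples by (auto simp: topspace_little_intervals_space)

lemma pathin_segment: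
  assumes "u \<in> ordered_intervals n" "v \<in> ordered_intervals n"
  shows "pathin (ordered_intervals_space n) (segment u v)"
  unfolding pathin_def
  by (rule continuous_map_segment[where f = "\<lambda>_. u" and g = "\<lambda>_. v" and s = "\<lambda>t. t"])
    (use assms ordered_intervals_subset_tuples in \<open>auto simp: topspace_little_intervals_space\<close>)

text \<open>
  The segment from \<open>c\<^sub>n\<close> to an ordered tuple consists of ordered tuples, so \<open>\<eta>\<close> is defined and
  multiplicative on all of them.
\<close>

lemma ordered_intervals_subset_path_component:
  "ordered_intervals n \<subseteq> path_component_of_set (little_intervals_space n) (std_intervals n)"
proof
  fix u assume u: "u \<in> ordered_intervals n"
  have "pathin (little_intervals_space n) (segment (std_intervals n) u)"
    using pathin_segment[OF std_intervals_ordered u] by (simp add: pathin_subtopology)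
  moreover have "length u = length (std_intervals n)"
    using u by (simp add: length_ordered_intervals std_intervals_def)
  ultimately show "u \<in> path_component_of_set (little_intervals_space n) (std_intervals n)"
    unfolding path_component_of_def mem_Collect_eq by (intro exI[of _ "segment (std_intervals n) u"]) simp
qed

text \<open>
  The straight-line homotopy, made of ordered tuples by convexity. This is why the linear paths below
  compose coherently.
\<close>

lemma path_homotopic_ordered_intervals:
  assumes "pathin (ordered_intervals_space n) p" "pathin (ordered_intervals_space n) q"
    and "p 0 = q 0" "p 1 = q 1"
  shows "path_homotopic (ordered_intervals_space n) p q"
proof (rule path_homotopicI[where h = "\<lambda>x. segment (p (snd x)) (q (snd x)) (fst x)"])
  have proj: "continuous_map (top_of_set unit_square) (top_of_set {0..1}) snd"
    by (auto simp: continuous_map_subtopology_eu intro: continuous_intros)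
  show "continuous_map (top_of_set unit_square) (ordered_intervals_space n)
     (\<lambda>x. segment (p (snd x)) (q (snd x)) (fst x))"
    by (rule continuous_map_segment)
      (use continuous_map_compose[OF proj] assms in
        \<open>auto simp: pathin_def o_def intro: continuous_intros\<close>)
  have len: "length (p t) = n" "length (q t) = n" if "t \<in> {0..1}" for t
    using assms that by (auto simp: pathin_subtopology intro: length_ordered_intervals)
  show "segment (p (snd (0, t))) (q (snd (0, t))) (fst (0, t)) = p t"
    "segment (p (snd (1, t))) (q (snd (1, t))) (fst (1, t)) = q t" if "t \<in> {0..1}" for t
    using len that by auto
qed (use assms in auto)

section \<open>Composition of interval configurations\<close>

lemma emb_comp_bounds:
  assumes "fst p < snd p" "0 \<le> fst q" "fst q < snd q" "snd q \<le> 1"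
  shows "fst p \<le> fst (emb_comp p q)" "fst (emb_comp p q) < snd (emb_comp p q)"
    "snd (emb_comp p q) \<le> snd p"
proof -
  show "fst p \<le> fst (emb_comp p q)" "fst (emb_comp p q) < snd (emb_comp p q)"
    using assms by (auto simp: emb_comp_def affine_emb_def)
  have "(snd p - fst p) * snd q \<le> (snd p - fst p) * 1"
    using assms by (intro mult_left_mono) auto
  then show "snd (emb_comp p q) \<le> snd p"
    by (simp add: emb_comp_def affine_emb_def)
qed

lemma emb_comp_assoc: "emb_comp (emb_comp p q) r = emb_comp p (emb_comp q r)"
  by (simp add: emb_comp_def affine_emb_def algebra_simps)

lemma little_intervals_comp_Nil [simp]: "little_intervals_comp ms [] [] = []"
  by (simp add: little_intervals_comp_def)

lemma little_intervals_comp_Cons [simp]: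
  "little_intervals_comp ms (p # c) (d # ds) =
     map (emb_comp p) d @ little_intervals_comp (tl ms) c ds"
  by (simp add: little_intervals_comp_def)

text \<open>
  The tuples \<open>d\<^sub>i\<close> are shrunk into the intervals of \<open>c\<close>, which are already separated from left to
  right. The induction also has to record that every new interval starts to the right of the start
  of some interval of \<open>c\<close>; this separates the first block from the remaining ones.
\<close>

lemma little_intervals_comp_in_ordered_intervals:
  assumes "c \<in> ordered_intervals (length ms)" "list_all2 (\<lambda>m d. d \<in> ordered_intervals m) ms ds"
  shows "little_intervals_comp ms c ds \<in> ordered_intervals (sum_list ms)"
proof -
  have "little_intervals_comp ms c ds \<in> ordered_intervals (sum_list ms) \<and>
     (\<forall>q \<in> set (little_intervals_comp ms c ds). \<exists>p \<in> set c. fst p \<le> fst q)"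
    using assms(2,1)
  proof (induction ms ds arbitrary: c rule: list_all2_induct)
    case (Cons m ms d ds c')
    have "length c' = Suc (length ms)"
      using length_ordered_intervals[OF Cons.prems] by simp
    then obtain p c where c': "c' = p # c" by (cases c') auto
    let ?r = "little_intervals_comp ms c ds"
    have c: "c \<in> ordered_intervals (length ms)"
      and p: "fst p < snd p" "0 \<le> fst p" "snd p \<le> 1" "\<And>q. q \<in> set c \<Longrightarrow> snd p \<le> fst q"
      using Cons.prems by (simp_all add: c' ordered_intervals_def)
    have IH: "?r \<in> ordered_intervals (sum_list ms)"
        "\<And>q. q \<in> set ?r \<Longrightarrow> \<exists>p \<in> set c. fst p \<le> fst q"
      using Cons.IH[OF c] by blast+
    have d: "length d = m" "sorted_wrt (\<lambda>p q. snd p \<le> fst q) d"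
        "\<And>q. q \<in> set d \<Longrightarrow> 0 \<le> fst q \<and> fst q < snd q \<and> snd q \<le> 1"
      using Cons.hyps by (auto simp: ordered_intervals_def)
    have pd: "fst p \<le> fst q \<and> fst q < snd q \<and> snd q \<le> snd p"
      if q: "q \<in> set (map (emb_comp p) d)" for q
    proof -
      obtain r where r: "r \<in> set d" "q = emb_comp p r"
        using q unfolding set_map by blast
      show ?thesis
        using emb_comp_bounds[of p r] p(1) d(3)[OF r(1)] by (simp only: r(2))
    qed
    have mono: "snd (emb_comp p q) \<le> fst (emb_comp p r)" if "snd q \<le> fst r" for q r
      using mult_left_mono[OF that, of "snd p - fst p"] p(1)
      by (simp add: emb_comp_def affine_emb_def)
    have "sorted_wrt (\<lambda>p q. snd p \<le> fst q) (map (emb_comp p) d)"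
      unfolding sorted_wrt_map
    proof (rule sorted_wrt_mono_rel[OF _ d(2)])
      show "snd (emb_comp p q) \<le> fst (emb_comp p r)" if "snd q \<le> fst r" for q r
        using that by (rule mono)
    qed
    moreover have "snd q \<le> fst r" if q: "q \<in> set (map (emb_comp p) d)" and r: "r \<in> set ?r" for q r
    proof -
      obtain p' where "p' \<in> set c" "fst p' \<le> fst r" using IH(2)[OF r] by blast
      with pd[OF q] p(4)[of p'] show ?thesis by linarith
    qed
    moreover have "sorted_wrt (\<lambda>p q. snd p \<le> fst q) ?r" "length ?r = sum_list ms"
        "\<And>q. q \<in> set ?r \<Longrightarrow> 0 \<le> fst q \<and> fst q < snd q \<and> snd q \<le> 1"
      using IH(1) unfolding ordered_intervals_def by blast+
    moreover have "0 \<le> fst q \<and> fst q < snd q \<and> snd q \<le> 1" if "q \<in> set (map (emb_comp p) d)" for q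
      using pd[OF that] p(2,3) by linarith
    moreover have "length (map (emb_comp p) d @ ?r) = m + sum_list ms"
      using d(1) IH(1) by (simp add: length_ordered_intervals)
    ultimately have "map (emb_comp p) d @ ?r \<in> ordered_intervals (m + sum_list ms)"
      unfolding ordered_intervals_def mem_Collect_eq sorted_wrt_append set_append
      by (intro conjI ballI) (auto simp only: Un_iff)
    moreover have "\<exists>p \<in> set c'. fst p \<le> fst q" if "q \<in> set (map (emb_comp p) d @ ?r)" for q
      using that pd[of q] IH(2)[of q] unfolding c' set_append by auto
    ultimately show ?case
      by (simp only: c' little_intervals_comp_Cons list.sel sum_list.Cons) blast
  qed (auto simp: ordered_intervals_def)
  then show ?thesis by blast
qed

lemma segment_append:
  "length a = length b \<Longrightarrow> segment (a @ c) (b @ d) t = segment a b t @ segment c d t"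
  by (simp add: segment_def)

text \<open>
  The composite of affine embeddings is affine in each factor separately. Composing a linear path with
  constant tuples, on either side, therefore gives a linear path again and not just a path homotopic
  to one.
\<close>

lemma little_intervals_comp_segment_left:
  assumes "length u = length v" "length v = length ds"
  shows "little_intervals_comp ms (segment u v t) ds =
     segment (little_intervals_comp ms u ds) (little_intervals_comp ms v ds) t"
  using assms
proof (induction u v ds arbitrary: ms rule: list_induct3)
  case (Cons p u q v d ds)
  have "emb_comp ((1 - t) *\<^sub>R p + t *\<^sub>R q) x = (1 - t) *\<^sub>R emb_comp p x + t *\<^sub>R emb_comp q x" for x
    by (simp add: emb_comp_def affine_emb_def prod_eq_iff algebra_simps)
  then have "map (emb_comp ((1 - t) *\<^sub>R p + t *\<^sub>R q)) d = segment (map (emb_comp p) d) (map (emb_comp q) d) t"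
    by (simp add: segment_def zip_map_map zip_same_conv_map)
  with Cons show ?case
    by (simp add: segment_append) (simp add: segment_def)
qed (simp add: segment_def)

lemma little_intervals_comp_segment_right:
  assumes "length c = length us" "list_all2 (\<lambda>u v. length u = length v) us vs"
  shows "little_intervals_comp ms c (map2 (\<lambda>u v. segment u v t) us vs) =
     segment (little_intervals_comp ms c us) (little_intervals_comp ms c vs) t"
proof -
  have "length us = length vs" using assms by (auto dest: list_all2_lengthD)
  from assms(1) this assms(2) show ?thesis
  proof (induction c us vs arbitrary: ms rule: list_induct3)
    case (Cons p c u us v vs)
    have "emb_comp p ((1 - t) *\<^sub>R x + t *\<^sub>R y) = (1 - t) *\<^sub>R emb_comp p x + t *\<^sub>R emb_comp p y" for x y
      by (simp add: emb_comp_def affine_emb_def prod_eq_iff algebra_simps)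
    then have "map (emb_comp p) (segment u v t) = segment (map (emb_comp p) u) (map (emb_comp p) v) t"
      by (simp add: segment_def zip_map_map case_prod_unfold)
    with Cons show ?case by (simp add: segment_append)
  qed (simp add: segment_def)
qed

lemma little_intervals_comp_append:
  "length c = length ds \<Longrightarrow> little_intervals_comp ms (c @ c') (ds @ ds') =
     little_intervals_comp ms' c ds @ little_intervals_comp ms'' c' ds'"
  by (simp add: little_intervals_comp_def)

lemma little_intervals_comp_map_emb_comp:
  "length b = length cs \<Longrightarrow> little_intervals_comp ms (map (emb_comp p) b) cs =
     map (emb_comp p) (little_intervals_comp ms' b cs)"
  by (induction b cs arbitrary: ms ms' rule: list_induct2) (auto simp: emb_comp_assoc)

lemma little_intervals_comp_assoc:
  assumes "length a = length bs" "list_all2 (\<lambda>b cs. length b = length cs) bs css"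
  shows "little_intervals_comp N (little_intervals_comp M a bs) (concat css) =
     little_intervals_comp S a (map2 (little_intervals_comp K) bs css)"
proof -
  have "length bs = length css" using assms by (auto dest: list_all2_lengthD)
  from assms(1) this assms(2) show ?thesis
  proof (induction a bs css arbitrary: M N S rule: list_induct3)
    case (Cons p a b bs cs css)
    then show ?case
      by (simp add: little_intervals_comp_append[where ms' = K and ms'' = N]
         little_intervals_comp_map_emb_comp[where ms' = K])
  qed simp
qed

lemma linear_path_endpoints [simp]:
  "length u = length v \<Longrightarrow> linear_path h u v 0 = h u"
  "length u = length v \<Longrightarrow> linear_path h u v 1 = h v"
  by (simp_all add: linear_path_eq_segment)

text \<open>
  The endpoint \<open>\<gamma>(c\<^sub>k; c\<^bsub>m\<^sub>1\<^esub>, \<dots>, c\<^bsub>m\<^sub>k\<^esub>)\<close> of the path \<open>\<delta>\<close>, before \<open>\<eta>\<close> is applied: a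
  division of \<open>[0, 1]\<close> into \<open>k\<close> equal parts, the \<open>i\<close>-th of which is divided into \<open>m\<^sub>i\<close> equal parts.
\<close>

definition subdivision :: "nat list \<Rightarrow> (real \<times> real) list" where
  "subdivision ms = little_intervals_comp ms (std_intervals (length ms)) (map std_intervals ms)"

lemma std_intervals_list: "list_all2 (\<lambda>m b. b \<in> ordered_intervals m) ms (map std_intervals ms)"
  by (simp add: list_all2_conv_all_nth std_intervals_ordered)

lemma subdivision_ordered: "subdivision ms \<in> ordered_intervals (sum_list ms)"
  unfolding subdivision_def
  by (intro little_intervals_comp_in_ordered_intervals std_intervals_list std_intervals_ordered)

lemma sum_list_concat_nat: "sum_list (concat nss) = sum_list (map sum_list (nss :: nat list list))"
  by (induction nss) auto

text \<open>
  Dividing in two stages and then once more gives the same intervals in either order. The two ways of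
  bracketing a composition of loops thus lead to linear paths with the same endpoint.
\<close>

lemma subdivision_assoc:
  "little_intervals_comp (concat nss) (subdivision (map length nss)) (map std_intervals (concat nss)) =
   little_intervals_comp (map sum_list nss) (std_intervals (length nss)) (map subdivision nss)"
proof -
  have "map2 (little_intervals_comp []) (map std_intervals (map length nss)) (map (map std_intervals) nss) =
      map subdivision nss"
    by (rule nth_equalityI) (auto simp: subdivision_def little_intervals_comp_def)
  moreover have "list_all2 (\<lambda>b cs. length b = length cs) (map std_intervals (map length nss)) (map (map std_intervals) nss)"
    by (simp add: list_all2_conv_all_nth std_intervals_def)
  ultimately show ?thesis
    using little_intervals_comp_assoc[of "std_intervals (length nss)"
        "map std_intervals (map length nss)" "map (map std_intervals) nss" "concat nss"
        "map length nss" "map sum_list nss" "[]"]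
    by (simp add: subdivision_def map_concat) (simp add: std_intervals_def)
qed

lemma std_intervals_1: "std_intervals 1 = [(0, 1)]"
  by (simp add: std_intervals_def)

lemma emb_comp_unit [simp]: "emb_comp (0, 1) q = q" "emb_comp p (0, 1) = p"
  by (simp_all add: emb_comp_def affine_emb_def)

lemma little_intervals_comp_units: "little_intervals_comp ms c (replicate (length c) [(0, 1)]) = c"
  by (induction c arbitrary: ms) auto

section \<open>Pointwise composition of paths\<close>

lemma topspace_kification [simp]: "topspace (kification X) = topspace X"
proof
  show "topspace X \<subseteq> topspace (kification X)"
    by (rule openin_subset) (auto simp: openin_kification openin_subtopology)
  show "topspace (kification X) \<subseteq> topspace X"
    using openin_topspace[of "kification X"] by (simp only: openin_kification)
qed

text \<open>
  An open set of the k-ification is open relative to every compact set, in particular relative to the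
  image of a compact space. Compact test spaces, such as the interval and the square, therefore do not
  see the difference between the two topologies.
\<close>

lemma continuous_map_into_kification:
  assumes Z: "compact_space Z" and f: "continuous_map Z X f"
  shows "continuous_map Z (kification X) f"
  unfolding continuous_map
proof (intro conjI allI impI)
  let ?K = "f ` topspace Z"
  have K: "compactin X ?K"
    using image_compactin[OF _ f] Z by (simp add: compact_space_def)
  show "f ` topspace Z \<subseteq> topspace (kification X)"
    using f by (auto simp: continuous_map)
  fix U assume "openin (kification X) U"
  then have "openin (subtopology X ?K) (?K \<inter> U)"
    using K by (simp add: openin_kification)
  moreover have "continuous_map Z (subtopology X ?K) f"
    using f by (simp add: continuous_map_in_subtopology)
  ultimately have "openin Z {x \<in> topspace Z. f x \<in> ?K \<inter> U}"
    by (rule openin_continuous_map_preimage[rotated])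
  moreover have "{x \<in> topspace Z. f x \<in> ?K \<inter> U} = {x \<in> topspace Z. f x \<in> U}" by auto
  ultimately show "openin Z {x \<in> topspace Z. f x \<in> U}" by simp
qed

lemma continuous_map_op_comp:
  assumes P: "topological_operad P" and Z: "compact_space Z"
    and a: "continuous_map Z (op_space P (length ms)) a"
    and len: "length bs = length ms"
    and b: "\<And>i. i < length ms \<Longrightarrow> continuous_map Z (op_space P (ms ! i)) (bs ! i)"
  shows "continuous_map Z (op_space P (sum_list ms)) (\<lambda>z. op_comp P ms (a z) (map (\<lambda>b. b z) bs))"
proof -
  let ?x = "\<lambda>z. (a z, \<lambda>i\<in>{..<length ms}. (bs ! i) z)"
  have "continuous_map Z (op_dom P ms) ?x"
    unfolding op_dom_def
    by (intro continuous_map_into_kification[OF Z] continuous_map_pairedI a)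
      (auto simp: continuous_map_componentwise intro: b)
  moreover have "continuous_map (op_dom P ms) (op_space P (sum_list ms))
      (\<lambda>(a, b). op_comp P ms a (map b [0..<length ms]))"
    using P by (simp add: topological_operad_def)
  ultimately have "continuous_map Z (op_space P (sum_list ms))
      ((\<lambda>(a, b). op_comp P ms a (map b [0..<length ms])) \<circ> ?x)"
    by (rule continuous_map_compose)
  moreover have "map (\<lambda>i\<in>{..<length ms}. (bs ! i) z) [0..<length ms] = map (\<lambda>b. b z) bs" for z
    using len by (intro nth_equalityI) auto
  ultimately show ?thesis by (simp add: o_def)
qed

text \<open>
  Homotopies of the arguments are composed pointwise as well; the square is compact, so the result is
  continuous.
\<close>

lemma path_homotopic_pointwise_comp:
  assumes P: "topological_operad P"
    and f: "path_homotopic (op_space P (length ms)) f f'"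
    and len: "length gs = length ms" "length gs' = length ms"
    and g: "\<And>i. i < length ms \<Longrightarrow> path_homotopic (op_space P (ms ! i)) (gs ! i) (gs' ! i)"
  shows "path_homotopic (op_space P (sum_list ms)) (pointwise_comp P ms f gs) (pointwise_comp P ms f' gs')"
proof -
  obtain h where h: "continuous_map (top_of_set unit_square) (op_space P (length ms)) h"
    "\<And>t. h (0, t) = f t" "\<And>t. h (1, t) = f' t"
    "\<And>s. s \<in> {0..1} \<Longrightarrow> h (s, 0) = f 0" "\<And>s. s \<in> {0..1} \<Longrightarrow> h (s, 1) = f 1"
    using path_homotopicE[OF f] by metis
  have "\<exists>k. continuous_map (top_of_set unit_square) (op_space P (ms ! i)) k \<and>
    (\<forall>t. k (0, t) = (gs ! i) t) \<and> (\<forall>t. k (1, t) = (gs' ! i) t) \<and>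
    (\<forall>s\<in>{0..1}. k (s, 0) = (gs ! i) 0) \<and> (\<forall>s\<in>{0..1}. k (s, 1) = (gs ! i) 1)"
    if "i < length ms" for i
    using path_homotopicE[OF g[OF that]] by metis
  then obtain k where "\<And>i. i < length ms \<Longrightarrow>
      continuous_map (top_of_set unit_square) (op_space P (ms ! i)) (k i) \<and>
      (\<forall>t. k i (0, t) = (gs ! i) t) \<and> (\<forall>t. k i (1, t) = (gs' ! i) t) \<and>
      (\<forall>s\<in>{0..1}. k i (s, 0) = (gs ! i) 0) \<and> (\<forall>s\<in>{0..1}. k i (s, 1) = (gs ! i) 1)"
    by metis
  then have k:
    "\<And>i. i < length ms \<Longrightarrow> continuous_map (top_of_set unit_square) (op_space P (ms ! i)) (k i)"
    "\<And>i t. i < length ms \<Longrightarrow> k i (0, t) = (gs ! i) t"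
    "\<And>i t. i < length ms \<Longrightarrow> k i (1, t) = (gs' ! i) t"
    "\<And>i s. i < length ms \<Longrightarrow> s \<in> {0..1} \<Longrightarrow> k i (s, 0) = (gs ! i) 0"
    "\<And>i s. i < length ms \<Longrightarrow> s \<in> {0..1} \<Longrightarrow> k i (s, 1) = (gs ! i) 1"
    by blast+
  \<comment> \<open>Collect one homotopy for each argument in a list, to be composed pointwise with \<open>h\<close>.\<close>
  let ?ks = "map k [0..<length ms]"
  have "compact_space (top_of_set unit_square)"
    by (simp add: compact_space_subtopology compact_Times)
  from continuous_map_op_comp[OF P this h(1), of ?ks] k(1)
  have "continuous_map (top_of_set unit_square) (op_space P (sum_list ms))
      (\<lambda>x. op_comp P ms (h x) (map (\<lambda>b. b x) ?ks))"
    by simp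
  moreover have "map (\<lambda>b. b (0, t)) ?ks = map (\<lambda>g. g t) gs"
    "map (\<lambda>b. b (1, t)) ?ks = map (\<lambda>g. g t) gs'" for t
    using len by (auto intro!: nth_equalityI simp: k)
  moreover have "map (\<lambda>b. b (s, 0)) ?ks = map (\<lambda>g. g 0) gs"
    "map (\<lambda>b. b (s, 1)) ?ks = map (\<lambda>g. g 1) gs" if "s \<in> {0..1}" for s
    using len k(4,5)[OF _ that] by (auto intro!: nth_equalityI)
  ultimately show ?thesis
    by (intro path_homotopicI[where h = "\<lambda>x. op_comp P ms (h x) (map (\<lambda>b. b x) ?ks)"])
      (simp_all only: pointwise_comp_def h)
qed

lemma pathin_pointwise_comp:
  assumes "topological_operad P" "pathin (op_space P (length ms)) f" "length gs = length ms"
    and "\<And>i. i < length ms \<Longrightarrow> pathin (op_space P (ms ! i)) (gs ! i)"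
  shows "pathin (op_space P (sum_list ms)) (pointwise_comp P ms f gs)"
  using path_homotopic_pointwise_comp[of P ms f f gs gs] assms
  by (auto simp: path_homotopic_refl intro: path_homotopic_endpoints(1))

lemma pointwise_comp_join:
  assumes "length gs = length gs'"
  shows "pointwise_comp P ms (path_join f f') (map2 path_join gs gs') =
     path_join (pointwise_comp P ms f gs) (pointwise_comp P ms f' gs')"
proof
  fix t
  have "map (\<lambda>g. g t) (map2 path_join gs gs') =
      (if t \<le> 1/2 then map (\<lambda>g. g (2 * t)) gs else map (\<lambda>g. g (2 * t - 1)) gs')"
    using assms by (intro nth_equalityI) (auto simp: path_join_def)
  then show "pointwise_comp P ms (path_join f f') (map2 path_join gs gs') t =
     path_join (pointwise_comp P ms f gs) (pointwise_comp P ms f' gs') t"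
    by (simp add: pointwise_comp_def path_join_def)
qed

lemma pointwise_comp_apply:
  "pointwise_comp P ms f gs t = op_comp P ms (f t) (map (\<lambda>g. g t) gs)"
  by (simp add: pointwise_comp_def)

lemma pointwise_comp_reverse:
  "pointwise_comp P ms (path_reverse f) (map path_reverse gs) = path_reverse (pointwise_comp P ms f gs)"
  by (simp add: pointwise_comp_def path_reverse_def fun_eq_iff o_def)

text \<open>
  Pointwise composition commutes with concatenation and reversal on the nose, hence also with
  conjugation.
\<close>

lemma pointwise_comp_conjugate:
  assumes "length \<delta>s = length gs"
  shows "pointwise_comp P ms (conjugate_path \<delta> f) (map2 conjugate_path \<delta>s gs) =
     conjugate_path (pointwise_comp P ms \<delta> \<delta>s) (pointwise_comp P ms f gs)"
proof -
  have "map2 conjugate_path \<delta>s gs = map2 path_join (map2 path_join \<delta>s gs) (map path_reverse \<delta>s)"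
    using assms by (intro nth_equalityI) (auto simp: conjugate_path_def)
  then show ?thesis
    using assms by (simp add: conjugate_path_def pointwise_comp_join pointwise_comp_reverse)
qed

section \<open>Discrete operads and trivial permutations\<close>

text \<open>
  A finite product of discrete spaces is discrete, and k-ification only adds open sets. For the operad
  of homotopy classes, continuity of the composition thus reduces to its being well defined.
\<close>

lemma continuous_map_op_dom_discrete:
  assumes sp: "\<And>n. op_space Q n = discrete_topology (C n)"
    and f: "\<And>a b. a \<in> C (length ms) \<Longrightarrow> (\<And>i. i < length ms \<Longrightarrow> b i \<in> C (ms ! i)) \<Longrightarrow> f (a, b) \<in> S"
  shows "continuous_map (op_dom Q ms) (discrete_topology S) f"
proof -
  let ?I = "{..<length ms}"
  have "product_topology (\<lambda>i. discrete_topology (C (ms ! i))) ?I = discrete_topology (\<Pi>\<^sub>E i\<in>?I. C (ms ! i))"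
  proof (rule discrete_topology_unique[THEN iffD2, symmetric], intro conjI ballI)
    fix x assume x: "x \<in> (\<Pi>\<^sub>E i\<in>?I. C (ms ! i))"
    then have "{x} = (\<Pi>\<^sub>E i\<in>?I. {x i})" by (simp add: PiE_singleton PiE_iff)
    moreover have "openin (product_topology (\<lambda>i. discrete_topology (C (ms ! i))) ?I) (\<Pi>\<^sub>E i\<in>?I. {x i})"
      using x by (auto simp: openin_PiE_gen)
    ultimately show "openin (product_topology (\<lambda>i. discrete_topology (C (ms ! i))) ?I) {x}" by simp
  qed simp
  then have dom: "op_dom Q ms = kification (discrete_topology (C (length ms) \<times> (\<Pi>\<^sub>E i\<in>?I. C (ms ! i))))"
    by (simp add: op_dom_def sp prod_topology_discrete_topology)
  show ?thesis
    unfolding dom continuous_map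
    using f by (auto simp: openin_kification openin_subtopology PiE_iff)
qed

text \<open>
  If no block is moved, the start of the block of \<open>x\<close> is the sum of the sizes of the preceding blocks,
  and the position of \<open>x\<close> inside the block is what remains.
\<close>

lemma symmetric_comp_id: "symmetric_comp ms id (replicate (length ms) id) = id"
proof
  fix x
  show "symmetric_comp ms id (replicate (length ms) id) x = id x"
  proof (cases "x < sum_list ms")
    case True
    let ?Q = "\<lambda>i. x < sum_list (take (Suc i) ms)"
    define i where "i = (LEAST i. ?Q i)"
    have ne: "ms \<noteq> []" using True by auto
    then have w: "?Q (length ms - 1)" using True by simp
    have "i \<le> length ms - 1" unfolding i_def using w by (rule Least_le)
    then have i: "i < length ms" using ne by (cases ms) auto
    have le: "sum_list (take i ms) \<le> x"
    proof (cases i)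
      case (Suc j)
      then have "\<not> ?Q j" using not_less_Least[of j ?Q] by (simp add: i_def)
      then show ?thesis using Suc by simp
    qed simp
    have "{p. p < length ms \<and> id p < id i} = {0..<i}" using i by auto
    then have "(\<Sum>p \<in> {p. p < length ms \<and> id p < id i}. ms ! p) = sum_list (take i ms)"
      using i by (simp add: sum_list_sum_nth)
    then show ?thesis
      using True le i by (simp add: symmetric_comp_def Let_def i_def[symmetric])
  qed (simp add: symmetric_comp_def)
qed

section \<open>Composition of loops at a good basepoint\<close>

locale based_operad =
  fixes P :: "'a operad" and \<eta> :: "nat \<Rightarrow> (real \<times> real) list \<Rightarrow> 'a" and e :: "nat \<Rightarrow> 'a"
  assumes operad: "topological_operad P" and basepoint: "good_basepoint P \<eta> e"
begin

abbreviation loops_at :: "nat \<Rightarrow> (real \<Rightarrow> 'a) set" where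
  "loops_at n \<equiv> loops (op_space P n) (e n)"

lemma e_eq: "e n = \<eta> n (std_intervals n)"
  using basepoint by (simp add: good_basepoint_def)

lemma ordered_intervals_subset_pts: "ordered_intervals n \<subseteq> op_pts little_intervals0 n"
  using ordered_intervals_subset_path_component[of n] ordered_intervals_subset_tuples[of n]
  by (auto simp: little_intervals0_def topspace_little_intervals_space)

lemma continuous_map_eta: "continuous_map (ordered_intervals_space n) (op_space P n) (\<eta> n)"
proof -
  have "continuous_map (op_space little_intervals0 n) (op_space P n) (\<eta> n)"
    using basepoint by (simp add: good_basepoint_def operad_morphism_def)
  then show ?thesis
    using continuous_map_from_subtopology_mono[OF _ ordered_intervals_subset_path_component]
    by (auto simp: little_intervals0_def)
qed

lemma eta_comp:
  assumes "a \<in> ordered_intervals (length ms)" "list_all2 (\<lambda>m b. b \<in> ordered_intervals m) ms bs"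
  shows "\<eta> (sum_list ms) (little_intervals_comp ms a bs) =
     op_comp P ms (\<eta> (length ms) a) (map2 \<eta> ms bs)"
proof -
  have "list_all2 (\<lambda>m b. b \<in> op_pts little_intervals0 m) ms bs"
    using assms(2) by (rule list_all2_mono) (use ordered_intervals_subset_pts in blast)
  moreover have "a \<in> op_pts little_intervals0 (length ms)"
    using assms(1) ordered_intervals_subset_pts by blast
  moreover have "op_comp little_intervals0 = little_intervals_comp"
    by (simp add: little_intervals0_def)
  ultimately show ?thesis
    using basepoint by (simp add: good_basepoint_def operad_morphism_def op_args_def)
qed

lemma eta_unit: "\<eta> 1 [(0, 1)] = op_unit P"
  using basepoint by (simp add: good_basepoint_def operad_morphism_def little_intervals0_def)

lemma pathin_linear_path:
  "u \<in> ordered_intervals n \<Longrightarrow> v \<in> ordered_intervals n \<Longrightarrow> pathin (op_space P n) (linear_path (\<eta> n) u v)"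
  unfolding linear_path_eq_segment by (rule pathin_compose[OF pathin_segment continuous_map_eta])

text \<open>
  Two consecutive linear paths may be replaced by the direct one, since the triangle can be filled among
  the ordered tuples and \<open>\<eta>\<close> carries the filling over.
\<close>

lemma path_homotopic_join_linear_path:
  assumes "u \<in> ordered_intervals n" "v \<in> ordered_intervals n" "w \<in> ordered_intervals n"
  shows "path_homotopic (op_space P n)
     (path_join (linear_path (\<eta> n) u v) (linear_path (\<eta> n) v w)) (linear_path (\<eta> n) u w)"
proof -
  have "path_homotopic (ordered_intervals_space n) (path_join (segment u v) (segment v w)) (segment u w)"
    by (rule path_homotopic_ordered_intervals)
      (use assms in \<open>auto simp: length_ordered_intervals intro!: pathin_join pathin_segment\<close>)
  from path_homotopic_compose[OF this continuous_map_eta]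
  show ?thesis by (simp add: linear_path_eq_segment path_join_def o_def if_distrib)
qed

lemma eta_subdivision: "\<eta> (sum_list ms) (subdivision ms) = op_comp P ms (e (length ms)) (map e ms)"
proof -
  have "map2 \<eta> ms (map std_intervals ms) = map e ms"
    by (rule nth_equalityI) (auto simp: e_eq)
  then show ?thesis
    unfolding subdivision_def
    by (subst eta_comp) (auto simp: std_intervals_list std_intervals_ordered e_eq)
qed

lemma delta_path_eq:
  "delta_path \<eta> ms = linear_path (\<eta> (sum_list ms)) (std_intervals (sum_list ms)) (subdivision ms)"
  by (simp add: delta_path_def subdivision_def)

lemma delta_path:
  "pathin (op_space P (sum_list ms)) (delta_path \<eta> ms)"
  "delta_path \<eta> ms 0 = e (sum_list ms)"
  "delta_path \<eta> ms 1 = op_comp P ms (e (length ms)) (map e ms)"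
  using length_ordered_intervals[OF subdivision_ordered, of ms]
    length_ordered_intervals[OF std_intervals_ordered, of "sum_list ms"]
  by (simp_all add: delta_path_eq pathin_linear_path subdivision_ordered std_intervals_ordered
      eta_subdivision e_eq[of "sum_list ms"])

text \<open>
  The loop \<open>\<delta> \<gamma>(f; g\<^sub>1, \<dots>, g\<^sub>k) \<delta>\<^sup>-\<^sup>1\<close>, a representative of the composite of the classes of
  \<open>f\<close> and \<open>g\<^sub>1, \<dots>, g\<^sub>k\<close>.
\<close>

definition loop_comp :: "nat list \<Rightarrow> (real \<Rightarrow> 'a) \<Rightarrow> (real \<Rightarrow> 'a) list \<Rightarrow> real \<Rightarrow> 'a" where
  "loop_comp ms f gs = conjugate_path (delta_path \<eta> ms) (pointwise_comp P ms f gs)"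

abbreviation loops_list :: "nat list \<Rightarrow> (real \<Rightarrow> 'a) list \<Rightarrow> bool" where
  "loops_list \<equiv> list_all2 (\<lambda>m g. g \<in> loops_at m)"

text \<open>
  The pointwise composite is a loop based at \<open>\<gamma>(e\<^sub>k; e\<^bsub>m\<^sub>1\<^esub>, \<dots>, e\<^bsub>m\<^sub>k\<^esub>)\<close>, where \<open>\<delta>\<close> ends.
\<close>

lemma pointwise_comp_loops:
  assumes "f \<in> loops_at (length ms)" "loops_list ms gs"
  shows "pathin (op_space P (sum_list ms)) (pointwise_comp P ms f gs)"
    "pointwise_comp P ms f gs 0 = delta_path \<eta> ms 1"
    "pointwise_comp P ms f gs 1 = delta_path \<eta> ms 1"
proof -
  have len: "length gs = length ms" and g: "gs ! i \<in> loops_at (ms ! i)" if "i < length ms" for i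
    using assms(2) that by (auto simp: list_all2_conv_all_nth)
  have len: "length gs = length ms" using assms(2) by (simp add: list_all2_lengthD)
  show "pathin (op_space P (sum_list ms)) (pointwise_comp P ms f gs)"
    using assms(1) g len by (intro pathin_pointwise_comp[OF operad]) (auto simp: loops_def)
  have "map (\<lambda>g. g 0) gs = map e ms" "map (\<lambda>g. g 1) gs = map e ms"
    using g len by (auto intro!: nth_equalityI simp: loops_def)
  then show "pointwise_comp P ms f gs 0 = delta_path \<eta> ms 1"
    "pointwise_comp P ms f gs 1 = delta_path \<eta> ms 1"
    using assms(1) by (auto simp: pointwise_comp_def delta_path loops_def)
qed

lemma loop_comp_loop:
  assumes "f \<in> loops_at (length ms)" "loops_list ms gs"
  shows "loop_comp ms f gs \<in> loops_at (sum_list ms)"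
  using pointwise_comp_loops[OF assms] delta_path[of ms]
  by (simp add: loop_comp_def loops_def pathin_conjugate)

lemma conjugated_comp_eq:
  assumes "f \<in> loops_at (length ms)" "loops_list ms gs"
  shows "conjugated_comp P \<eta> ms f gs = path_class (op_space P (sum_list ms)) (loop_comp ms f gs)"
  using pointwise_comp_loops[OF assms] delta_path(1)[of ms]
  by (simp add: conjugated_comp_def Let_def class_mult_path_class class_inverse_path_class
      pathin_join pathin_reverse loop_comp_def conjugate_path_def)

lemma loop_comp_cong:
  assumes "f \<in> loops_at (length ms)" "loops_list ms gs"
    and "path_homotopic (op_space P (length ms)) f f'" "length gs' = length ms"
    and "\<And>i. i < length ms \<Longrightarrow> path_homotopic (op_space P (ms ! i)) (gs ! i) (gs' ! i)"
  shows "path_homotopic (op_space P (sum_list ms)) (loop_comp ms f gs) (loop_comp ms f' gs')"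
  unfolding loop_comp_def
  by (intro path_homotopic_conjugate path_homotopic_refl path_homotopic_pointwise_comp[OF operad])
    (use assms pointwise_comp_loops[OF assms(1,2)] delta_path(1)[of ms] in \<open>auto dest: list_all2_lengthD\<close>)

text \<open>
  The union over all representatives in \<^const>\<open>pi1_comp\<close> is taken over a nonempty family of equal sets,
  by homotopy invariance.
\<close>

lemma pi1_comp_eq:
  assumes f: "f \<in> loops_at (length ms)" and gs: "loops_list ms gs"
  shows "pi1_comp P \<eta> ms (path_class (op_space P (length ms)) f)
      (map2 (\<lambda>m g. path_class (op_space P m) g) ms gs) =
     path_class (op_space P (sum_list ms)) (loop_comp ms f gs)"
proof -
  let ?A = "path_class (op_space P (length ms)) f"
  let ?Bs = "map2 (\<lambda>m g. path_class (op_space P m) g) ms gs"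
  have len: "length gs = length ms" using gs by (simp add: list_all2_lengthD)
  have g: "gs ! i \<in> loops_at (ms ! i)" if "i < length ms" for i
    using gs that by (auto simp: list_all2_conv_all_nth)
  have same: "conjugated_comp P \<eta> ms f' gs' = path_class (op_space P (sum_list ms)) (loop_comp ms f gs)"
    if f': "f' \<in> ?A" and gs': "list_all2 (\<lambda>B g. g \<in> B) ?Bs gs'" for f' gs'
  proof -
    have h: "path_homotopic (op_space P (length ms)) f f'"
      using f' by (simp add: path_class_eq_Collect)
    have len': "length gs' = length ms"
      and hs: "\<And>i. i < length ms \<Longrightarrow> path_homotopic (op_space P (ms ! i)) (gs ! i) (gs' ! i)"
      using gs' len by (auto simp: path_class_eq_Collect list_all2_conv_all_nth)
    have "f' \<in> loops_at (length ms)" using f h by (rule loops_path_homotopic)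
    moreover have "loops_list ms gs'"
      using len' hs g by (auto simp: list_all2_conv_all_nth intro: loops_path_homotopic)
    ultimately show ?thesis
      using path_class_eqI[OF loop_comp_cong[OF f gs h len' hs]]
      by (simp add: conjugated_comp_eq)
  qed
  have "f \<in> ?A" using f by (simp add: path_class_eq_Collect path_homotopic_refl loops_def)
  moreover have "list_all2 (\<lambda>B g. g \<in> B) ?Bs gs"
    using g len
    by (auto simp: list_all2_conv_all_nth path_class_eq_Collect loops_def intro: path_homotopic_refl)
  ultimately show ?thesis
    unfolding pi1_comp_def using same by (intro equalityI subsetI) blast+
qed

lemma e_in_pts: "e n \<in> op_pts P n"
  using continuous_map_eta[of n] std_intervals_ordered[of n] topspace_ordered_intervals_space[of n]
  by (auto simp: e_eq continuous_map)

lemma pi1_groups_simps: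
  "carrier (pi1_groups P e n) = path_class (op_space P n) ` loops_at n"
  "mult (pi1_groups P e n) = class_mult (op_space P n)"
  "one (pi1_groups P e n) = path_class (op_space P n) (\<lambda>_. e n)"
  by (simp_all add: pi1_groups_def fundamental_group_def)

lemma group_pi1_groups: "group (pi1_groups P e n)"
  unfolding pi1_groups_def by (rule group_fundamental_group[OF e_in_pts])

lemma pi1_groups_list_representatives:
  assumes "list_all2 (\<lambda>m b. b \<in> carrier (pi1_groups P e m)) ms bs"
  obtains gs where "loops_list ms gs" "bs = map2 (\<lambda>m g. path_class (op_space P m) g) ms gs"
proof -
  have "\<exists>gs. loops_list ms gs \<and> bs = map2 (\<lambda>m g. path_class (op_space P m) g) ms gs"
    using assms
  proof (induction ms bs rule: list_all2_induct)
    case (Cons m ms b bs)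
    then obtain gs where gs: "loops_list ms gs" "bs = map2 (\<lambda>m g. path_class (op_space P m) g) ms gs"
      by blast
    obtain g where "g \<in> loops_at m" "b = path_class (op_space P m) g"
      using Cons.hyps by (auto simp: pi1_groups_simps)
    with gs show ?case by (intro exI[of _ "g # gs"]) simp
  qed simp
  then show thesis using that by blast
qed

text \<open>
  Pointwise composition turns concatenated arguments into concatenated values, and conjugation by
  \<open>\<delta>\<close> is multiplicative.
\<close>

lemma loop_comp_mult:
  assumes f: "f \<in> loops_at (length ms)" "f' \<in> loops_at (length ms)"
    and g: "loops_list ms gs" "loops_list ms gs'"
  shows "path_homotopic (op_space P (sum_list ms))
     (loop_comp ms (path_join f f') (map2 path_join gs gs'))
     (path_join (loop_comp ms f gs) (loop_comp ms f' gs'))"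
proof -
  have "length gs = length gs'"
    using list_all2_lengthD[OF g(1)] list_all2_lengthD[OF g(2)] by simp
  then show ?thesis
    unfolding loop_comp_def
    using path_homotopic_sym[OF path_homotopic_conjugate_join[OF delta_path(1)[of ms]
      pointwise_comp_loops(1)[OF f(1) g(1)] pointwise_comp_loops(1)[OF f(2) g(2)]]]
      pointwise_comp_loops[OF f(1) g(1)] pointwise_comp_loops[OF f(2) g(2)]
    by (simp add: pointwise_comp_join)
qed

section \<open>Associativity up to homotopy\<close>

text \<open>
  Since \<open>\<eta>\<close> is a morphism, composing a linear path with basepoints happens among interval tuples,
  where the result is linear again.
\<close>

lemma linear_path_comp_left:
  assumes u: "u \<in> ordered_intervals (length ms)" and v: "v \<in> ordered_intervals (length ms)"
  shows "path_homotopic (op_space P (sum_list ms))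
     (pointwise_comp P ms (linear_path (\<eta> (length ms)) u v) (map (\<lambda>m _. e m) ms))
     (linear_path (\<eta> (sum_list ms)) (little_intervals_comp ms u (map std_intervals ms))
        (little_intervals_comp ms v (map std_intervals ms)))"
proof (rule path_homotopic_sym[OF path_homotopic_eqI])
  show "pathin (op_space P (sum_list ms))
     (linear_path (\<eta> (sum_list ms)) (little_intervals_comp ms u (map std_intervals ms))
        (little_intervals_comp ms v (map std_intervals ms)))"
    by (intro pathin_linear_path little_intervals_comp_in_ordered_intervals u v std_intervals_list)
  fix t :: real assume t: "t \<in> {0..1}"
  have "segment (little_intervals_comp ms u (map std_intervals ms))
      (little_intervals_comp ms v (map std_intervals ms)) t =
      little_intervals_comp ms (segment u v t) (map std_intervals ms)"
    using length_ordered_intervals[OF u] length_ordered_intervals[OF v]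
    by (subst little_intervals_comp_segment_left) auto
  moreover have "map2 \<eta> ms (map std_intervals ms) = map e ms"
    by (rule nth_equalityI) (auto simp: e_eq)
  ultimately show "linear_path (\<eta> (sum_list ms)) (little_intervals_comp ms u (map std_intervals ms))
        (little_intervals_comp ms v (map std_intervals ms)) t =
     pointwise_comp P ms (linear_path (\<eta> (length ms)) u v) (map (\<lambda>m _. e m) ms) t"
    by (simp add: linear_path_eq_segment pointwise_comp_def o_def
        eta_comp[OF segment_in_ordered_intervals[OF u v t] std_intervals_list])
qed

lemma linear_path_comp_right:
  assumes u: "list_all2 (\<lambda>m u. u \<in> ordered_intervals m) ms us"
    and v: "list_all2 (\<lambda>m v. v \<in> ordered_intervals m) ms vs"
  shows "path_homotopic (op_space P (sum_list ms))
     (pointwise_comp P ms (\<lambda>_. e (length ms))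
        (map (\<lambda>i. linear_path (\<eta> (ms ! i)) (us ! i) (vs ! i)) [0..<length ms]))
     (linear_path (\<eta> (sum_list ms)) (little_intervals_comp ms (std_intervals (length ms)) us)
        (little_intervals_comp ms (std_intervals (length ms)) vs))"
proof (rule path_homotopic_sym[OF path_homotopic_eqI])
  let ?c = "std_intervals (length ms)"
  show "pathin (op_space P (sum_list ms))
     (linear_path (\<eta> (sum_list ms)) (little_intervals_comp ms ?c us) (little_intervals_comp ms ?c vs))"
    by (intro pathin_linear_path little_intervals_comp_in_ordered_intervals u v std_intervals_ordered)
  fix t :: real assume t: "t \<in> {0..1}"
  let ?w = "map2 (\<lambda>u v. segment u v t) us vs"
  have len: "length us = length ms" "length vs = length ms"
    using u v by (auto dest: list_all2_lengthD)
  have uv: "us ! i \<in> ordered_intervals (ms ! i)" "vs ! i \<in> ordered_intervals (ms ! i)"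
    if "i < length ms" for i
    using u v that by (auto simp: list_all2_conv_all_nth)
  have "list_all2 (\<lambda>u v. length u = length v) us vs"
    using length_ordered_intervals[OF uv(1)] length_ordered_intervals[OF uv(2)] len
    by (simp add: list_all2_conv_all_nth)
  then have "segment (little_intervals_comp ms ?c us) (little_intervals_comp ms ?c vs) t =
      little_intervals_comp ms ?c ?w"
    using len by (subst little_intervals_comp_segment_right) (auto simp: std_intervals_def)
  moreover have "list_all2 (\<lambda>m w. w \<in> ordered_intervals m) ms ?w"
    using uv len t by (auto simp: list_all2_conv_all_nth intro: segment_in_ordered_intervals)
  moreover have "map2 \<eta> ms ?w =
      map (\<lambda>g. g t) (map (\<lambda>i. linear_path (\<eta> (ms ! i)) (us ! i) (vs ! i)) [0..<length ms])"
    using len by (intro nth_equalityI) (auto simp: linear_path_eq_segment)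
  ultimately show "linear_path (\<eta> (sum_list ms)) (little_intervals_comp ms ?c us)
        (little_intervals_comp ms ?c vs) t =
     pointwise_comp P ms (\<lambda>_. e (length ms))
        (map (\<lambda>i. linear_path (\<eta> (ms ! i)) (us ! i) (vs ! i)) [0..<length ms]) t"
    by (simp add: linear_path_eq_segment pointwise_comp_def o_def e_eq
        eta_comp[OF std_intervals_ordered])
qed

lemma op_comp_assoc:
  assumes "a \<in> op_pts P (length nss)" "op_args P (map length nss) bs" "list_all2 (op_args P) nss css"
  shows "op_comp P (concat nss) (op_comp P (map length nss) a bs) (concat css) =
        op_comp P (map sum_list nss) a
          (map (\<lambda>i. op_comp P (nss ! i) (bs ! i) (css ! i)) [0..<length nss])"
  using operad assms unfolding topological_operad_def by blast

lemma loops_list_op_args: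
  "loops_list ms gs \<Longrightarrow> t \<in> {0..1} \<Longrightarrow> op_args P ms (map (\<lambda>g. g t) gs)"
  by (auto simp: op_args_def list_all2_conv_all_nth loops_def intro: pathin_in_topspace)

lemma pointwise_comp_assoc:
  assumes f: "f \<in> loops_at (length nss)" and g: "loops_list (map length nss) gs"
    and h: "list_all2 loops_list nss hss" and t: "t \<in> {0..1}"
  shows "pointwise_comp P (concat nss) (pointwise_comp P (map length nss) f gs) (concat hss) t =
     pointwise_comp P (map sum_list nss) f
       (map (\<lambda>i. pointwise_comp P (nss ! i) (gs ! i) (hss ! i)) [0..<length nss]) t"
proof -
  have "f t \<in> op_pts P (length nss)"
    using f t by (simp add: loops_def pathin_in_topspace)
  moreover have "list_all2 (op_args P) nss (map (map (\<lambda>h. h t)) hss)"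
    using h t by (auto simp: list_all2_conv_all_nth[of _ nss] intro: loops_list_op_args)
  moreover have "length gs = length nss" "length hss = length nss"
    using list_all2_lengthD[OF g] list_all2_lengthD[OF h] by simp_all
  moreover from this have eq: "map (\<lambda>i. op_comp P (nss ! i) (map (\<lambda>g. g t) gs ! i)
        (map (map (\<lambda>h. h t)) hss ! i)) [0..<length nss] =
      map (\<lambda>i. op_comp P (nss ! i) ((gs ! i) t) (map (\<lambda>h. h t) (hss ! i))) [0..<length nss]"
    by auto
  ultimately show ?thesis
    using op_comp_assoc[of "f t" nss "map (\<lambda>g. g t) gs" "map (map (\<lambda>h. h t)) hss", unfolded eq]
      loops_list_op_args[OF g t]
    by (simp add: pointwise_comp_apply map_concat o_def)
qed

lemma loop_conjugate_const:
  "g \<in> loops_at n \<Longrightarrow> path_homotopic (op_space P n) g (conjugate_path (\<lambda>_. e n) g)"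
  by (auto simp: loops_def intro: path_homotopic_sym[OF path_homotopic_conjugate_const])

text \<open>
  Let \<open>\<gamma>\<close> stand for pointwise composition of paths. The inner composite is the conjugate
  \<open>\<delta>\<^sub>1 \<gamma>(f; g) \<delta>\<^sub>1\<^sup>-\<^sup>1\<close>, and each \<open>h\<close> is padded by constant paths to match, so that the outer
  composite becomes \<open>\<delta>\<^sub>2 D \<gamma>(\<gamma>(f; g); h) D\<^sup>-\<^sup>1 \<delta>\<^sub>2\<^sup>-\<^sup>1\<close>, where \<open>D = \<gamma>(\<delta>\<^sub>1; e, \<dots>, e)\<close>.
  Both \<open>\<delta>\<^sub>2\<close> and \<open>D\<close> are linear paths, so \<open>\<delta>\<^sub>2 D\<close> is homotopic to the linear path from
  \<open>e\<^sub>n\<close> to the end of \<open>D\<close>.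
\<close>

lemma loop_comp_assoc_left:
  assumes f: "f \<in> loops_at (length nss)" and g: "loops_list (map length nss) gs"
    and h: "list_all2 loops_list nss hss"
  shows "path_homotopic (op_space P (sum_list (concat nss)))
     (loop_comp (concat nss) (loop_comp (map length nss) f gs) (concat hss))
     (conjugate_path
        (linear_path (\<eta> (sum_list (concat nss))) (std_intervals (sum_list (concat nss)))
          (little_intervals_comp (concat nss) (subdivision (map length nss))
            (map std_intervals (concat nss))))
        (pointwise_comp P (concat nss) (pointwise_comp P (map length nss) f gs) (concat hss)))"
proof -
  let ?N = "concat nss" and ?M = "map length nss" and ?H = "concat hss"
  let ?X = "op_space P (sum_list ?N)"
  let ?E = "map (\<lambda>n _. e n) ?N"
  let ?x = "pointwise_comp P ?N (pointwise_comp P ?M f gs) ?H"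
  let ?D = "pointwise_comp P ?N (delta_path \<eta> ?M) ?E"
  let ?w = "little_intervals_comp ?N (subdivision ?M) (map std_intervals ?N)"
  have lenN: "length ?N = sum_list ?M" by (simp add: length_concat)
  have H: "loops_list ?N ?H" using h by (rule concat_transfer[THEN rel_funD])
  have f': "f \<in> loops_at (length ?M)" using f by simp
  note pf = pointwise_comp_loops[OF f' g]
  have H': "?H ! i \<in> loops_at (?N ! i)" if "i < length ?N" for i
    using H that by (auto simp: list_all2_conv_all_nth)
  have lenH: "length ?H = length ?N" using H by (simp add: list_all2_lengthD)
  have F: "loop_comp ?M f gs \<in> loops_at (length ?N)"
    using loop_comp_loop[OF f' g] lenN by simp
  have x: "pathin ?X ?x"
    using pf(1) lenN H' lenH by (intro pathin_pointwise_comp[OF operad]) (auto simp: loops_def)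
  have D: "pathin ?X ?D"
    using delta_path(1)[of ?M] lenN e_in_pts by (intro pathin_pointwise_comp[OF operad]) auto
  have ends: "map (\<lambda>g. g 0) ?H = map e ?N" "map (\<lambda>g. g 1) ?H = map e ?N"
    using H' lenH by (auto intro!: nth_equalityI simp: loops_def)
  have D0: "delta_path \<eta> ?N 1 = ?D 0"
    using lenN by (simp add: delta_path pointwise_comp_def o_def)
  have D1: "?D 1 = ?x 0" "?x 1 = ?x 0"
    using pf ends by (simp_all add: pointwise_comp_def o_def)
  have "path_homotopic ?X (pointwise_comp P ?N (loop_comp ?M f gs) ?H)
      (pointwise_comp P ?N (conjugate_path (delta_path \<eta> ?M) (pointwise_comp P ?M f gs))
        (map2 conjugate_path ?E ?H))"
  proof (rule path_homotopic_pointwise_comp[OF operad])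
    show "path_homotopic (op_space P (length ?N)) (loop_comp ?M f gs)
       (conjugate_path (delta_path \<eta> ?M) (pointwise_comp P ?M f gs))"
      using F by (auto simp: loop_comp_def loops_def intro: path_homotopic_refl)
    show "path_homotopic (op_space P (?N ! i)) (?H ! i) (map2 conjugate_path ?E ?H ! i)"
      if "i < length ?N" for i
      using loop_conjugate_const[OF H'[OF that]] that lenH by simp
  qed (use lenH in auto)
  then have "path_homotopic ?X (pointwise_comp P ?N (loop_comp ?M f gs) ?H) (conjugate_path ?D ?x)"
    using lenH by (simp add: pointwise_comp_conjugate)
  then have "path_homotopic ?X (loop_comp ?N (loop_comp ?M f gs) ?H)
      (conjugate_path (delta_path \<eta> ?N) (conjugate_path ?D ?x))"
    unfolding loop_comp_def[of ?N]
    using pointwise_comp_loops[OF F H] delta_path(1)[of ?N]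
    by (intro path_homotopic_conjugate path_homotopic_refl) auto
  also have "path_homotopic ?X \<dots> (conjugate_path (path_join (delta_path \<eta> ?N) ?D) ?x)"
    using delta_path(1)[of ?N] D x D0 D1 by (intro path_homotopic_conjugate_conjugate) auto
  also have "path_homotopic ?X \<dots>
     (conjugate_path (linear_path (\<eta> (sum_list ?N)) (std_intervals (sum_list ?N)) ?w) ?x)"
  proof (rule path_homotopic_conjugate)
    have sub: "subdivision ?M \<in> ordered_intervals (length ?N)"
      using subdivision_ordered[of ?M] lenN by simp
    have std: "std_intervals (length ?N) \<in> ordered_intervals (length ?N)"
      by (rule std_intervals_ordered)
    have w: "?w \<in> ordered_intervals (sum_list ?N)"
      by (intro little_intervals_comp_in_ordered_intervals sub std_intervals_list)
    have "path_homotopic ?X ?D (linear_path (\<eta> (sum_list ?N)) (subdivision ?N) ?w)"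
      using linear_path_comp_left[OF std sub] lenN by (simp add: delta_path_eq subdivision_def[of ?N])
    then have "path_homotopic ?X (path_join (delta_path \<eta> ?N) ?D)
        (path_join (delta_path \<eta> ?N) (linear_path (\<eta> (sum_list ?N)) (subdivision ?N) ?w))"
      using delta_path(1)[of ?N] D0 by (intro path_homotopic_join path_homotopic_refl)
    also have "path_homotopic ?X \<dots>
        (linear_path (\<eta> (sum_list ?N)) (std_intervals (sum_list ?N)) ?w)"
      unfolding delta_path_eq
      by (intro path_homotopic_join_linear_path std_intervals_ordered subdivision_ordered w)
    finally show "path_homotopic ?X (path_join (delta_path \<eta> ?N) ?D)
        (linear_path (\<eta> (sum_list ?N)) (std_intervals (sum_list ?N)) ?w)" .
  qed (use x D1 in \<open>auto intro: path_homotopic_refl\<close>)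
  finally show ?thesis .
qed

text \<open>
  The mirror image of the previous lemma: now the inner composites \<open>\<gamma>(g\<^sub>i; h\<^sub>i)\<close> are the conjugates,
  by paths \<open>\<delta>\<^sub>i\<close>, and \<open>f\<close> is padded by constant paths. The conjugating path is
  \<open>\<delta> \<gamma>(e; \<delta>\<^sub>1, \<dots>, \<delta>\<^sub>k)\<close>, again homotopic to a linear one.
\<close>

lemma loop_comp_assoc_right:
  assumes f: "f \<in> loops_at (length nss)" and g: "loops_list (map length nss) gs"
    and h: "list_all2 loops_list nss hss"
  shows "path_homotopic (op_space P (sum_list (map sum_list nss)))
     (loop_comp (map sum_list nss) f
        (map (\<lambda>i. loop_comp (nss ! i) (gs ! i) (hss ! i)) [0..<length nss]))
     (conjugate_path
        (linear_path (\<eta> (sum_list (map sum_list nss))) (std_intervals (sum_list (map sum_list nss)))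
          (little_intervals_comp (map sum_list nss) (std_intervals (length nss))
            (map subdivision nss)))
        (pointwise_comp P (map sum_list nss) f
          (map (\<lambda>i. pointwise_comp P (nss ! i) (gs ! i) (hss ! i)) [0..<length nss])))"
proof -
  let ?S = "map sum_list nss" and ?k = "length nss"
  let ?X = "op_space P (sum_list ?S)"
  let ?Ds = "map (\<lambda>i. delta_path \<eta> (nss ! i)) [0..<?k]"
  let ?Xs = "map (\<lambda>i. pointwise_comp P (nss ! i) (gs ! i) (hss ! i)) [0..<?k]"
  let ?G = "map (\<lambda>i. loop_comp (nss ! i) (gs ! i) (hss ! i)) [0..<?k]"
  let ?x = "pointwise_comp P ?S f ?Xs"
  let ?D = "pointwise_comp P ?S (\<lambda>_. e ?k) ?Ds"
  let ?w = "little_intervals_comp ?S (std_intervals ?k) (map subdivision nss)"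
  have gh: "gs ! i \<in> loops_at (length (nss ! i))" "loops_list (nss ! i) (hss ! i)" if "i < ?k" for i
    using g h that by (auto simp: list_all2_conv_all_nth[of _ nss] list_all2_conv_all_nth[of _ "map length nss"])
  note pf = pointwise_comp_loops[OF gh]
  have G: "loops_list ?S ?G"
    using loop_comp_loop[OF gh] by (auto simp: list_all2_conv_all_nth)
  have f': "f \<in> loops_at (length ?S)" using f by simp
  have x: "pathin ?X ?x"
    using f pf(1) by (intro pathin_pointwise_comp[OF operad]) (auto simp: loops_def)
  have D: "pathin ?X ?D"
    using e_in_pts delta_path(1) by (intro pathin_pointwise_comp[OF operad]) auto
  have D0: "delta_path \<eta> ?S 1 = ?D 0"
    by (auto simp: delta_path pointwise_comp_def o_def intro!: arg_cong[of _ _ "op_comp P _ _"] nth_equalityI)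
  have "map (\<lambda>g. g 0) ?Xs = map (\<lambda>g. g 1) ?Ds" "map (\<lambda>g. g 1) ?Xs = map (\<lambda>g. g 1) ?Ds"
    using pf by auto
  moreover have "f 0 = e ?k" "f 1 = e ?k" using f by (simp_all add: loops_def)
  ultimately have D1: "?D 1 = ?x 0" "?x 1 = ?x 0"
    by (simp_all only: pointwise_comp_apply[of P ?S])
  have "path_homotopic ?X (pointwise_comp P ?S f ?G)
      (pointwise_comp P ?S (conjugate_path (\<lambda>_. e ?k) f) (map2 conjugate_path ?Ds ?Xs))"
  proof (rule path_homotopic_pointwise_comp[OF operad])
    show "path_homotopic (op_space P (length ?S)) f (conjugate_path (\<lambda>_. e ?k) f)"
      using loop_conjugate_const[OF f] by simp
    show "path_homotopic (op_space P (?S ! i)) (?G ! i) (map2 conjugate_path ?Ds ?Xs ! i)"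
      if "i < length ?S" for i
      using loop_comp_loop[OF gh] that by (auto simp: loop_comp_def loops_def intro: path_homotopic_refl)
  qed auto
  then have "path_homotopic ?X (pointwise_comp P ?S f ?G) (conjugate_path ?D ?x)"
    by (simp add: pointwise_comp_conjugate)
  then have "path_homotopic ?X (loop_comp ?S f ?G)
      (conjugate_path (delta_path \<eta> ?S) (conjugate_path ?D ?x))"
    unfolding loop_comp_def[of ?S]
    using pointwise_comp_loops[OF f' G] delta_path(1)[of ?S]
    by (intro path_homotopic_conjugate path_homotopic_refl) auto
  also have "path_homotopic ?X \<dots> (conjugate_path (path_join (delta_path \<eta> ?S) ?D) ?x)"
    using delta_path(1)[of ?S] D x D0 D1 by (intro path_homotopic_conjugate_conjugate) auto
  also have "path_homotopic ?X \<dots>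
     (conjugate_path (linear_path (\<eta> (sum_list ?S)) (std_intervals (sum_list ?S)) ?w) ?x)"
  proof (rule path_homotopic_conjugate)
    have sub: "list_all2 (\<lambda>m u. u \<in> ordered_intervals m) ?S (map subdivision nss)"
      by (auto simp: list_all2_conv_all_nth subdivision_ordered)
    have w: "?w \<in> ordered_intervals (sum_list ?S)"
      by (rule little_intervals_comp_in_ordered_intervals[OF _ sub]) (simp add: std_intervals_ordered)
    have "map (\<lambda>i. linear_path (\<eta> (?S ! i)) (map std_intervals ?S ! i) (map subdivision nss ! i)) [0..<length ?S] = ?Ds"
      by (auto simp: delta_path_eq)
    then have "path_homotopic ?X ?D (linear_path (\<eta> (sum_list ?S)) (subdivision ?S) ?w)"
      using linear_path_comp_right[OF std_intervals_list sub]
      by (simp only: length_map subdivision_def[of ?S])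
    then have "path_homotopic ?X (path_join (delta_path \<eta> ?S) ?D)
        (path_join (delta_path \<eta> ?S) (linear_path (\<eta> (sum_list ?S)) (subdivision ?S) ?w))"
      using delta_path(1)[of ?S] D0 by (intro path_homotopic_join path_homotopic_refl)
    also have "path_homotopic ?X \<dots>
        (linear_path (\<eta> (sum_list ?S)) (std_intervals (sum_list ?S)) ?w)"
      unfolding delta_path_eq
      by (intro path_homotopic_join_linear_path std_intervals_ordered subdivision_ordered w)
    finally show "path_homotopic ?X (path_join (delta_path \<eta> ?S) ?D)
        (linear_path (\<eta> (sum_list ?S)) (std_intervals (sum_list ?S)) ?w)" .
  qed (use x D1 in \<open>auto intro: path_homotopic_refl\<close>)
  finally show ?thesis .
qed

text \<open>
  After the two normalizations only equalities remain: the linear paths have the same endpoints by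
  associativity in the little intervals operad, and the pointwise composites agree by associativity in
  \<open>P\<close>.
\<close>

lemma loop_comp_assoc:
  assumes f: "f \<in> loops_at (length nss)" and g: "loops_list (map length nss) gs"
    and h: "list_all2 loops_list nss hss"
  shows "path_homotopic (op_space P (sum_list (map sum_list nss)))
     (loop_comp (concat nss) (loop_comp (map length nss) f gs) (concat hss))
     (loop_comp (map sum_list nss) f
        (map (\<lambda>i. loop_comp (nss ! i) (gs ! i) (hss ! i)) [0..<length nss]))"
proof -
  let ?X = "op_space P (sum_list (map sum_list nss))"
  let ?w = "little_intervals_comp (map sum_list nss) (std_intervals (length nss)) (map subdivision nss)"
  let ?L = "linear_path (\<eta> (sum_list (map sum_list nss))) (std_intervals (sum_list (map sum_list nss))) ?w"
  let ?x = "pointwise_comp P (concat nss) (pointwise_comp P (map length nss) f gs) (concat hss)"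
  let ?y = "pointwise_comp P (map sum_list nss) f
          (map (\<lambda>i. pointwise_comp P (nss ! i) (gs ! i) (hss ! i)) [0..<length nss])"
  have left: "path_homotopic ?X (loop_comp (concat nss) (loop_comp (map length nss) f gs) (concat hss))
      (conjugate_path ?L ?x)"
    using loop_comp_assoc_left[OF assms] by (simp add: sum_list_concat_nat subdivision_assoc)
  also have "path_homotopic ?X \<dots> (conjugate_path ?L ?y)"
  proof (rule path_homotopic_eqI)
    show "pathin ?X (conjugate_path ?L ?x)" using path_homotopic_endpoints(2)[OF left] .
    show "conjugate_path ?L ?x t = conjugate_path ?L ?y t" if "t \<in> {0..1}" for t
      using that pointwise_comp_assoc[OF assms] by (simp add: conjugate_path_def path_join_def)
  qed
  also have "path_homotopic ?X \<dots> (loop_comp (map sum_list nss) f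
        (map (\<lambda>i. loop_comp (nss ! i) (gs ! i) (hss ! i)) [0..<length nss]))"
    by (rule path_homotopic_sym[OF loop_comp_assoc_right[OF assms]])
  finally show ?thesis .
qed

section \<open>Units up to homotopy\<close>

lemma e_1: "e 1 = op_unit P"
  using eta_unit by (simp add: e_eq std_intervals_def)

text \<open>
  In both unit laws the subdivision is already the standard one, so that \<open>\<delta>\<close> is constant and
  conjugation by it is invisible.
\<close>

lemma loop_comp_trivial:
  assumes "subdivision ms = std_intervals (sum_list ms)" "g \<in> loops_at (sum_list ms)"
    and "\<And>t. t \<in> {0..1} \<Longrightarrow> pointwise_comp P ms f gs t = g t"
  shows "path_homotopic (op_space P (sum_list ms)) (loop_comp ms f gs) g"
proof -
  have "delta_path \<eta> ms = (\<lambda>_. e (sum_list ms))"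
    by (simp add: delta_path_eq assms(1) linear_path_eq_segment e_eq o_def)
  then have "conjugate_path (\<lambda>_. e (sum_list ms)) g t = loop_comp ms f gs t" if "t \<in> {0..1}" for t
    using that assms(3) by (simp add: loop_comp_def conjugate_path_def path_join_def path_reverse_def)
  then have "path_homotopic (op_space P (sum_list ms)) (conjugate_path (\<lambda>_. e (sum_list ms)) g) (loop_comp ms f gs)"
    using assms(2) path_homotopic_endpoints(2)[OF loop_conjugate_const[OF assms(2)]]
    by (intro path_homotopic_eqI)
  then show ?thesis
    using loop_conjugate_const[OF assms(2)] path_homotopic_sym path_homotopic_trans by blast
qed

lemma loop_comp_unit_left:
  assumes g: "g \<in> loops_at n"
  shows "path_homotopic (op_space P n) (loop_comp [n] (\<lambda>_. e 1) [g]) g"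
proof -
  have "subdivision [n] = std_intervals n"
    by (simp add: subdivision_def std_intervals_1[simplified] map_idI[of _ "emb_comp (0, 1)"])
  moreover have "pointwise_comp P [n] (\<lambda>_. e 1) [g] t = g t" if "t \<in> {0..1}" for t
  proof -
    have "g t \<in> op_pts P n" using g that by (simp add: loops_def pathin_in_topspace)
    then have "op_comp P [n] (op_unit P) [g t] = g t"
      using operad unfolding topological_operad_def by blast
    then show ?thesis by (simp add: pointwise_comp_apply e_1[simplified])
  qed
  ultimately show ?thesis using loop_comp_trivial[of "[n]" g] g by simp
qed

lemma loop_comp_unit_right:
  assumes f: "f \<in> loops_at n"
  shows "path_homotopic (op_space P n) (loop_comp (replicate n 1) f (replicate n (\<lambda>_. e 1))) f"
proof -
  have n: "sum_list (replicate n 1) = n" by (simp add: sum_list_replicate)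
  have "subdivision (replicate n 1) = std_intervals n"
    using little_intervals_comp_units[of "replicate n 1" "std_intervals n"]
    by (simp only: subdivision_def map_replicate std_intervals_1 length_replicate
        length_ordered_intervals[OF std_intervals_ordered])
  moreover have "pointwise_comp P (replicate n 1) f (replicate n (\<lambda>_. e 1)) t = f t" if "t \<in> {0..1}" for t
  proof -
    have "f t \<in> op_pts P n" using f that by (simp add: loops_def pathin_in_topspace)
    then have "op_comp P (replicate n 1) (f t) (replicate n (op_unit P)) = f t"
      using operad unfolding topological_operad_def by blast
    then show ?thesis by (simp only: pointwise_comp_apply e_1 map_replicate)
  qed
  ultimately show ?thesis using loop_comp_trivial[of "replicate n 1" f] f unfolding n by blast
qed

section \<open>The operad of fundamental groups\<close>

abbreviation path_classes :: "nat list \<Rightarrow> (real \<Rightarrow> 'a) list \<Rightarrow> (real \<Rightarrow> 'a) set list" where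
  "path_classes ms gs \<equiv> map2 (\<lambda>m g. path_class (op_space P m) g) ms gs"

abbreviation pi1_operad :: "(real \<Rightarrow> 'a) set operad" where
  "pi1_operad \<equiv> operad_of_groups (pi1_groups P e) (pi1_comp P \<eta>)"

lemma op_args_pi1_operad:
  "op_args pi1_operad ms bs \<longleftrightarrow> list_all2 (\<lambda>m b. b \<in> carrier (pi1_groups P e m)) ms bs"
  by (simp add: op_args_def operad_of_groups_def)

lemma pi1_operad_simps [simp]:
  "op_space pi1_operad n = discrete_topology (carrier (pi1_groups P e n))"
  "op_comp pi1_operad = pi1_comp P \<eta>"
  "op_unit pi1_operad = path_class (op_space P 1) (\<lambda>_. e 1)"
  by (simp_all add: operad_of_groups_def pi1_groups_simps)

lemma pi1_comp_closed:
  assumes a: "a \<in> carrier (pi1_groups P e (length ms))"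
    and bs: "list_all2 (\<lambda>m b. b \<in> carrier (pi1_groups P e m)) ms bs"
  shows "pi1_comp P \<eta> ms a bs \<in> carrier (pi1_groups P e (sum_list ms))"
proof -
  obtain f where f: "f \<in> loops_at (length ms)" "a = path_class (op_space P (length ms)) f"
    using a by (auto simp: pi1_groups_simps)
  obtain gs where gs: "loops_list ms gs" "bs = path_classes ms gs"
    using pi1_groups_list_representatives[OF bs] .
  show ?thesis
    using pi1_comp_eq[OF f(1) gs(1)] loop_comp_loop[OF f(1) gs(1)]
    by (simp add: f(2) gs(2) pi1_groups_simps)
qed

lemma pi1_groups_nested_representatives:
  assumes "list_all2 (op_args pi1_operad) nss css"
  obtains hss where "list_all2 loops_list nss hss" "css = map2 path_classes nss hss"
proof -
  have "\<exists>hss. list_all2 loops_list nss hss \<and> css = map2 path_classes nss hss"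
    using assms
  proof (induction nss css rule: list_all2_induct)
    case (Cons ns nss cs css)
    then obtain hss where hss: "list_all2 loops_list nss hss" "css = map2 path_classes nss hss"
      by blast
    obtain hs where "loops_list ns hs" "cs = path_classes ns hs"
      using pi1_groups_list_representatives Cons.hyps(1) unfolding op_args_pi1_operad by blast
    with hss show ?case by (intro exI[of _ "hs # hss"]) simp
  qed simp
  then show thesis using that by blast
qed

lemma concat_classes:
  "list_all2 loops_list nss hss \<Longrightarrow> concat (map2 path_classes nss hss) = path_classes (concat nss) (concat hss)"
  by (induction nss hss rule: list_all2_induct) (auto dest: list_all2_lengthD)

lemma pi1_comp_assoc:
  assumes a: "a \<in> carrier (pi1_groups P e (length nss))"
    and bs: "list_all2 (\<lambda>m b. b \<in> carrier (pi1_groups P e m)) (map length nss) bs"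
    and css: "list_all2 (op_args pi1_operad) nss css"
  shows "pi1_comp P \<eta> (concat nss) (pi1_comp P \<eta> (map length nss) a bs) (concat css) =
     pi1_comp P \<eta> (map sum_list nss) a
       (map (\<lambda>i. pi1_comp P \<eta> (nss ! i) (bs ! i) (css ! i)) [0..<length nss])"
proof -
  let ?N = "concat nss" and ?M = "map length nss" and ?S = "map sum_list nss"
  obtain f where f: "f \<in> loops_at (length nss)" and a_eq: "a = path_class (op_space P (length nss)) f"
    using a by (auto simp: pi1_groups_simps)
  obtain gs where gs: "loops_list ?M gs" and bs_eq: "bs = path_classes ?M gs"
    using pi1_groups_list_representatives[OF bs] .
  obtain hss where hss: "list_all2 loops_list nss hss" and css_eq: "css = map2 path_classes nss hss"
    using pi1_groups_nested_representatives[OF css] .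
  let ?G = "map (\<lambda>i. loop_comp (nss ! i) (gs ! i) (hss ! i)) [0..<length nss]"
  have len: "length gs = length nss" "length hss = length nss"
    using list_all2_lengthD[OF gs] list_all2_lengthD[OF hss] by simp_all
  have gh: "gs ! i \<in> loops_at (length (nss ! i))" "loops_list (nss ! i) (hss ! i)"
    if "i < length nss" for i
    using gs hss that
    by (auto simp: list_all2_conv_all_nth[of _ nss] list_all2_conv_all_nth[of _ "map length nss"])
  have G: "loops_list ?S ?G"
    using loop_comp_loop[OF gh] by (auto simp: list_all2_conv_all_nth)
  have lenN: "length ?N = sum_list ?M" by (simp add: length_concat)
  have H: "loops_list ?N (concat hss)" using hss by (rule concat_transfer[THEN rel_funD])
  have f': "f \<in> loops_at (length ?M)" "f \<in> loops_at (length ?S)" using f by simp_all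
  have F: "loop_comp ?M f gs \<in> loops_at (length ?N)"
    using loop_comp_loop[OF f'(1) gs] lenN by simp
  have "pi1_comp P \<eta> ?M a bs = path_class (op_space P (length ?N)) (loop_comp ?M f gs)"
    using pi1_comp_eq[OF f'(1) gs] lenN by (simp add: a_eq bs_eq)
  then have "pi1_comp P \<eta> ?N (pi1_comp P \<eta> ?M a bs) (concat css) =
      path_class (op_space P (sum_list ?N)) (loop_comp ?N (loop_comp ?M f gs) (concat hss))"
    using pi1_comp_eq[OF F H] by (simp only: css_eq concat_classes[OF hss])
  also have "\<dots> = path_class (op_space P (sum_list ?S)) (loop_comp ?S f ?G)"
    using path_class_eqI[OF loop_comp_assoc[OF f gs hss]] by (simp add: sum_list_concat_nat)
  also have "\<dots> = pi1_comp P \<eta> ?S a (path_classes ?S ?G)"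
    using pi1_comp_eq[OF f'(2) G] by (simp add: a_eq)
  also have "path_classes ?S ?G = map (\<lambda>i. pi1_comp P \<eta> (nss ! i) (bs ! i) (css ! i)) [0..<length nss]"
  proof (rule nth_equalityI)
    fix i assume "i < length (path_classes ?S ?G)"
    then have i: "i < length nss" by simp
    then have "bs ! i = path_class (op_space P (length (nss ! i))) (gs ! i)"
      "css ! i = path_classes (nss ! i) (hss ! i)"
      using len by (simp_all add: bs_eq css_eq)
    then show "path_classes ?S ?G ! i = map (\<lambda>i. pi1_comp P \<eta> (nss ! i) (bs ! i) (css ! i)) [0..<length nss] ! i"
      using i pi1_comp_eq[OF gh[OF i]] by simp
  qed simp
  finally show ?thesis .
qed

lemma pi1_comp_unit_left:
  assumes "a \<in> carrier (pi1_groups P e n)"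
  shows "pi1_comp P \<eta> [n] (path_class (op_space P 1) (\<lambda>_. e 1)) [a] = a"
proof -
  obtain f where f: "f \<in> loops_at n" "a = path_class (op_space P n) f"
    using assms by (auto simp: pi1_groups_simps)
  have "(\<lambda>_. e 1) \<in> loops_at (length [n])" using loops_const[OF e_in_pts[of 1]] by simp
  from pi1_comp_eq[OF this, of "[f]"] show ?thesis
    using f path_class_eqI[OF loop_comp_unit_left[OF f(1)]] by simp
qed

lemma pi1_comp_unit_right:
  assumes "a \<in> carrier (pi1_groups P e n)"
  shows "pi1_comp P \<eta> (replicate n 1) a (replicate n (path_class (op_space P 1) (\<lambda>_. e 1))) = a"
proof -
  obtain f where f: "f \<in> loops_at n" "a = path_class (op_space P n) f"
    using assms by (auto simp: pi1_groups_simps)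
  have 1: "f \<in> loops_at (length (replicate n 1))" using f by simp
  have 2: "loops_list (replicate n 1) (replicate n (\<lambda>_. e 1))"
    using loops_const[OF e_in_pts[of 1]] by (simp add: list_all2_conv_all_nth)
  have n: "sum_list (replicate n 1) = n" by (simp add: sum_list_replicate)
  have "path_classes (replicate n 1) (replicate n (\<lambda>_. e 1)) = replicate n (path_class (op_space P 1) (\<lambda>_. e 1))"
    by (intro nth_equalityI) auto
  with pi1_comp_eq[OF 1 2] path_class_eqI[OF loop_comp_unit_right[OF f(1)]] show ?thesis
    by (simp only: n length_replicate f(2))
qed

lemma pi1_groups_0: "carrier (pi1_groups P e 0) = {path_class (op_space P 0) (\<lambda>_. e 0)}"
proof -
  obtain x where x: "op_pts P 0 = {x}"
    using operad unfolding topological_operad_def by blast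
  have "path_class (op_space P 0) f = path_class (op_space P 0) (\<lambda>_. e 0)" if f: "f \<in> loops_at 0" for f
  proof (rule path_class_eqI[OF path_homotopic_eqI])
    show p: "pathin (op_space P 0) f" using f by (simp add: loops_def)
    fix t :: real assume "t \<in> {0..1}"
    then have "f t \<in> op_pts P 0" using p by (rule pathin_in_topspace[rotated])
    then show "f t = e 0" using e_in_pts[of 0] unfolding x by (simp only: singleton_iff)
  qed
  then show ?thesis
    unfolding pi1_groups_simps using loops_const[OF e_in_pts[of 0]] by blast
qed

lemma topological_operad_pi1: "topological_operad pi1_operad"
  unfolding topological_operad_def
proof (intro conjI allI impI ballI; (elim conjE)?)
  show "k_space (op_space pi1_operad n)" "Hausdorff_space (op_space pi1_operad n)" for n
    by (simp_all add: k_space_discrete_topology)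
  show "\<exists>x. op_pts pi1_operad 0 = {x}" by (simp add: pi1_groups_0)
  show "continuous_map (op_dom pi1_operad ms) (op_space pi1_operad (sum_list ms))
      (\<lambda>(a, b). op_comp pi1_operad ms a (map b [0..<length ms]))" for ms
    unfolding pi1_operad_simps(1)[of "sum_list ms"]
    by (rule continuous_map_op_dom_discrete[OF pi1_operad_simps(1)])
      (auto intro!: pi1_comp_closed simp: list_all2_conv_all_nth)
  show "op_unit pi1_operad \<in> op_pts pi1_operad 1"
    using loops_const[OF e_in_pts[of 1]] by (simp add: pi1_groups_simps)
  show "op_comp pi1_operad [n] (op_unit pi1_operad) [a] = a" if "a \<in> op_pts pi1_operad n" for n a
    using that pi1_comp_unit_left by simp
  show "op_comp pi1_operad (replicate n 1) a (replicate n (op_unit pi1_operad)) = a"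
    if "a \<in> op_pts pi1_operad n" for n a
    using that pi1_comp_unit_right[of a n] by simp
  show "op_comp pi1_operad (concat nss) (op_comp pi1_operad (map length nss) a bs) (concat css) =
      op_comp pi1_operad (map sum_list nss) a
       (map (\<lambda>i. op_comp pi1_operad (nss ! i) (bs ! i) (css ! i)) [0..<length nss])"
    if "a \<in> op_pts pi1_operad (length nss)" "op_args pi1_operad (map length nss) bs"
      "list_all2 (op_args pi1_operad) nss css" for nss a bs css
    using that pi1_comp_assoc[of a nss bs css] by (simp add: op_args_pi1_operad)
qed

lemma operad_morphism_trivial: "operad_morphism pi1_operad symmetric_operad (\<lambda>n a. id)"
  unfolding operad_morphism_def
proof (intro conjI allI impI)
  show "continuous_map (op_space pi1_operad n) (op_space symmetric_operad n) (\<lambda>a. id)" for n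
    by (simp add: symmetric_operad_def symmetric_group_def permutes_id)
  show "id = op_unit symmetric_operad" by (simp add: symmetric_operad_def)
  fix ms a bs assume "a \<in> op_pts pi1_operad (length ms) \<and> op_args pi1_operad ms bs"
  then have "length bs = length ms" by (auto simp: op_args_def dest: list_all2_lengthD)
  then have "map2 (\<lambda>n a. id) ms bs = replicate (length ms) (id :: nat \<Rightarrow> nat)"
    by (intro nth_equalityI) auto
  then show "id = op_comp symmetric_operad ms id (map2 (\<lambda>n a. id) ms bs)"
    by (simp add: symmetric_operad_def symmetric_comp_id)
qed

text \<open>
  The interchange law in the absence of permutations: each composition map is a homomorphism.
\<close>

lemma pi1_comp_mult:
  assumes a: "a \<in> carrier (pi1_groups P e (length ms))" "a' \<in> carrier (pi1_groups P e (length ms))"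
    and b: "list_all2 (\<lambda>m b. b \<in> carrier (pi1_groups P e m)) ms bs"
      "list_all2 (\<lambda>m b. b \<in> carrier (pi1_groups P e m)) ms bs'"
  shows "pi1_comp P \<eta> ms (a \<otimes>\<^bsub>pi1_groups P e (length ms)\<^esub> a')
       (map (\<lambda>i. bs ! i \<otimes>\<^bsub>pi1_groups P e (ms ! i)\<^esub> bs' ! i) [0..<length ms]) =
     pi1_comp P \<eta> ms a bs \<otimes>\<^bsub>pi1_groups P e (sum_list ms)\<^esub> pi1_comp P \<eta> ms a' bs'"
proof -
  obtain f f' where f: "f \<in> loops_at (length ms)" "f' \<in> loops_at (length ms)"
    and a_eq: "a = path_class (op_space P (length ms)) f" "a' = path_class (op_space P (length ms)) f'"
    using a by (auto simp: pi1_groups_simps)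
  obtain gs where gs: "loops_list ms gs" and bs_eq: "bs = path_classes ms gs"
    using pi1_groups_list_representatives[OF b(1)] .
  obtain gs' where gs': "loops_list ms gs'" and bs'_eq: "bs' = path_classes ms gs'"
    using pi1_groups_list_representatives[OF b(2)] .
  have mult: "path_class (op_space P n) p \<otimes>\<^bsub>pi1_groups P e n\<^esub> path_class (op_space P n) q =
      path_class (op_space P n) (path_join p q)" if "p \<in> loops_at n" "q \<in> loops_at n" for n p q
    using that by (simp add: pi1_groups_simps loops_def class_mult_path_class)
  have len: "length gs = length ms" "length gs' = length ms"
    using list_all2_lengthD[OF gs] list_all2_lengthD[OF gs'] by simp_all
  have g: "gs ! i \<in> loops_at (ms ! i)" "gs' ! i \<in> loops_at (ms ! i)" if "i < length ms" for i
    using gs gs' that by (auto simp: list_all2_conv_all_nth)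
  have ff: "path_join f f' \<in> loops_at (length ms)" using f by (rule loops_join)
  have gg: "loops_list ms (map2 path_join gs gs')"
    using g len by (auto simp: list_all2_conv_all_nth intro: loops_join)
  have "map (\<lambda>i. bs ! i \<otimes>\<^bsub>pi1_groups P e (ms ! i)\<^esub> bs' ! i) [0..<length ms] =
      path_classes ms (map2 path_join gs gs')"
    using g len by (intro nth_equalityI) (auto simp: bs_eq bs'_eq mult)
  then have "pi1_comp P \<eta> ms (a \<otimes>\<^bsub>pi1_groups P e (length ms)\<^esub> a')
       (map (\<lambda>i. bs ! i \<otimes>\<^bsub>pi1_groups P e (ms ! i)\<^esub> bs' ! i) [0..<length ms]) =
     path_class (op_space P (sum_list ms)) (loop_comp ms (path_join f f') (map2 path_join gs gs'))"
    using pi1_comp_eq[OF ff gg] by (simp only: a_eq mult[OF f])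
  also have "\<dots> = path_class (op_space P (sum_list ms)) (path_join (loop_comp ms f gs) (loop_comp ms f' gs'))"
    by (rule path_class_eqI[OF loop_comp_mult[OF f gs gs']])
  also have "\<dots> = pi1_comp P \<eta> ms a bs \<otimes>\<^bsub>pi1_groups P e (sum_list ms)\<^esub> pi1_comp P \<eta> ms a' bs'"
    using mult[OF loop_comp_loop[OF f(1) gs] loop_comp_loop[OF f(2) gs']]
    by (simp only: a_eq bs_eq bs'_eq pi1_comp_eq[OF f(1) gs] pi1_comp_eq[OF f(2) gs'])
  finally show ?thesis .
qed

lemma permute_list_by_id: "permute_list_by id xs = xs"
  by (simp add: permute_list_by_def map_nth)

lemma noncrossed_group_operad_pi1:
  "noncrossed_group_operad (pi1_groups P e) (pi1_comp P \<eta>) (\<lambda>n a. id)"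
proof -
  have "(\<lambda>a. id) \<in> hom (pi1_groups P e n) (symmetric_group n)" for n
    by (auto simp: hom_def symmetric_group_def permutes_id)
  then show ?thesis
    unfolding noncrossed_group_operad_def group_operad_def permute_list_by_id
    using topological_operad_pi1 operad_morphism_trivial group_pi1_groups pi1_comp_mult by blast
qed

end

theorem theorem3p3:
  fixes P :: "'a operad"
    and \<eta> :: "nat \<Rightarrow> (real \<times> real) list \<Rightarrow> 'a"
    and e :: "nat \<Rightarrow> 'a"
  assumes "topological_operad P"
    and "path_connected_operad P"
    and "good_basepoint P \<eta> e"
  shows "(\<forall>ms f gs. f \<in> loops (op_space P (length ms)) (e (length ms)) \<and>
            list_all2 (\<lambda>m g. g \<in> loops (op_space P m) (e m)) ms gs \<longrightarrow>
            pi1_comp P \<eta> ms (path_class (op_space P (length ms)) f)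
              (map2 (\<lambda>m g. path_class (op_space P m) g) ms gs) =
            conjugated_comp P \<eta> ms f gs) \<and>
         noncrossed_group_operad (pi1_groups P e) (pi1_comp P \<eta>) (\<lambda>n a. id)"
proof -
  interpret based_operad P \<eta> e
    using assms(1,3) by unfold_locales
  show ?thesis
    using pi1_comp_eq conjugated_comp_eq noncrossed_group_operad_pi1 by simp
qed

end
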